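(* Let $P:\mathfrak{E}\to\mathfrak{B}$ be a 2-functor between 2-categories. Then $P$ is a 2-fibration if and only if the induced strict double functor $\mathbb{Q}(P):\mathbb{Q}(\mathfrak{E})\to\mathbb{Q}(\mathfrak{B})$ between double categories of quintets is a double fibration.
   Context: **2-fibrations.** An arrow $f:X\to Y$ of $\mathfrak{E}$ is 2-Cartesian (for $P$) if (1) it is Cartesian for the underlying functor of $P$: for every $g:Z\to Y$ and $h:PZ\to PX$ with $Pf\circ h=Pg$ there is a unique $\hat h:Z\to X$ over $h$ with $f\hat h=g$; and (2) whenever $\theta:g\Rightarrow k$ is a 2-cell of $\mathfrak{E}$ (with $g,k:Z\to Y$) and $\gamma:h\Rightarrow l$ is a 2-cell of $\mathfrak{B}$ with $P\theta=Pf*\gamma$, there is a unique 2-cell $\hat\gamma:\hat h\Rightarrow\hat l$ over $\gamma$ with $f*\hat\gamma=\theta$. $P$ is a 2-fibration if (1) every arrow $B\to PY$ of $\mathfrak{B}$ has a 2-Cartesian arrow above it with codomain $Y$; (2) each functor $P:\mathfrak{E}(X,Y)\to\mathfrak{B}(PX,PY)$ is a fibration; (3) horizontal composites of Cartesian 2-cells (2-cells Cartesian for these local fibrations) are again Cartesian. All 2-fibrations are assumed cloven, i.e. equipped with a choice of 2-Cartesian lifts and of local cleavages. **Quintets.** For a 2-category $\mathfrak{K}$, $\mathbb{Q}(\mathfrak{K})$ is the double category whose objects are those of $\mathfrak{K}$, whose arrows and proarrows are both the arrows of $\mathfrak{K}$, and whose cells with internal domain $m:A\to B$, internal codomain $n:C\to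 D$, external source $f:A\to C$ and external target $g:B\to D$ are the 2-cells $g\,m\Rightarrow n\,f$ of $\mathfrak{K}$; internal and external compositions are by pasting. A 2-functor $P$ induces a strict double functor $\mathbb{Q}(P)$ in the evident way. **Double fibrations.** For a double category $\mathbb{D}$, $\mathbb{D}_0$ is the category of objects and arrows, $\mathbb{D}_1$ the category of proarrows and cells (with internal composition), $\mathsf{src},\mathsf{tgt}$ are external source and target, $y$ and $\otimes$ external unit and composition. A strict double functor $P:\mathbb{E}\to\mathbb{B}$ is (defines) a double fibration when $P_0:\mathbb{E}_0\to\mathbb{B}_0$ and $P_1:\mathbb{E}_1\to\mathbb{B}_1$ are fibrations, there exist cleavages for $P_0$ and $P_1$ (choices of Cartesian lifts) such that $\mathsf{src}_{\mathbb{E}},\mathsf{tgt}_{\mathbb{E}}$ are simultaneously cleavage-preserving, and $y_{\mathbb{E}}$ and $\otimes_{\mathbb{E}}$ preserve Cartesian arrows. *)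

theory Defs
  imports Main
begin

section \<open>Categories, functors and fibrations\<close>

text \<open>All structures have explicit carriers: the operations are total functions on the ambient
  types, but only their values on the carriers are constrained or compared.\<close>

record ('o, 'a) cat =
  Obj :: "'o set"
  Arr :: "'a set"
  Dom :: "'a \<Rightarrow> 'o"
  Cod :: "'a \<Rightarrow> 'o"
  Idn :: "'o \<Rightarrow> 'a"
  Cmp :: "'a \<Rightarrow> 'a \<Rightarrow> 'a"  (infixr "\<cdot>\<index>" 70)

definition hom :: "('o, 'a) cat \<Rightarrow> 'o \<Rightarrow> 'o \<Rightarrow> 'a set" where
  "hom C X Y = {f \<in> Arr C. Dom C f = X \<and> Cod C f = Y}"

locale category =
  fixes C :: "('o, 'a) cat" (structure)
  assumes Dom_in_Obj: "f \<in> Arr C \<Longrightarrow> Dom C f \<in> Obj C"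
    and Cod_in_Obj: "f \<in> Arr C \<Longrightarrow> Cod C f \<in> Obj C"
    and Idn_in_hom: "X \<in> Obj C \<Longrightarrow> Idn C X \<in> hom C X X"
    and Cmp_in_hom: "f \<in> hom C X Y \<Longrightarrow> g \<in> hom C Y Z \<Longrightarrow> g \<cdot> f \<in> hom C X Z"
    and Cmp_Idn: "f \<in> hom C X Y \<Longrightarrow> f \<cdot> Idn C X = f"
    and Idn_Cmp: "f \<in> hom C X Y \<Longrightarrow> Idn C Y \<cdot> f = f"
    and Cmp_assoc: "f \<in> hom C W X \<Longrightarrow> g \<in> hom C X Y \<Longrightarrow> h \<in> hom C Y Z
      \<Longrightarrow> (h \<cdot> g) \<cdot> f = h \<cdot> (g \<cdot> f)"

record ('o, 'a, 'p, 'b) func =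
  fob :: "'o \<Rightarrow> 'p"
  far :: "'a \<Rightarrow> 'b"

locale cat_functor =
  C: category C + D: category D
  for C :: "('o, 'a) cat" and D :: "('p, 'b) cat" and F :: "('o, 'a, 'p, 'b) func" +
  assumes fob_in_Obj: "X \<in> Obj C \<Longrightarrow> fob F X \<in> Obj D"
    and far_in_hom: "f \<in> hom C X Y \<Longrightarrow> far F f \<in> hom D (fob F X) (fob F Y)"
    and far_Idn: "X \<in> Obj C \<Longrightarrow> far F (Idn C X) = Idn D (fob F X)"
    and far_Cmp: "f \<in> hom C X Y \<Longrightarrow> g \<in> hom C Y Z
      \<Longrightarrow> far F (g \<cdot>\<^bsub>C\<^esub> f) = far F g \<cdot>\<^bsub>D\<^esub> far F f"

definition cartesian ::
  "('o, 'a) cat \<Rightarrow> ('p, 'b) cat \<Rightarrow> ('o, 'a, 'p, 'b) func \<Rightarrow> 'a \<Rightarrow> bool" where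
  "cartesian E B P f \<longleftrightarrow> f \<in> Arr E \<and>
     (\<forall>Z\<in>Obj E. \<forall>g\<in>hom E Z (Cod E f). \<forall>h\<in>hom B (fob P Z) (fob P (Dom E f)).
        far P f \<cdot>\<^bsub>B\<^esub> h = far P g \<longrightarrow>
        (\<exists>!k. k \<in> hom E Z (Dom E f) \<and> far P k = h \<and> f \<cdot>\<^bsub>E\<^esub> k = g))"

definition cartesian_lift ::
  "('o, 'a) cat \<Rightarrow> ('p, 'b) cat \<Rightarrow> ('o, 'a, 'p, 'b) func \<Rightarrow> 'o \<Rightarrow> 'b \<Rightarrow> 'a \<Rightarrow> bool" where
  "cartesian_lift E B P Y u f \<longleftrightarrow> cartesian E B P f \<and> Cod E f = Y \<and> far P f = u"

definition fibration :: "('o, 'a) cat \<Rightarrow> ('p, 'b) cat \<Rightarrow> ('o, 'a, 'p, 'b) func \<Rightarrow> bool" where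
  "fibration E B P \<longleftrightarrow> cat_functor E B P \<and>
     (\<forall>Y\<in>Obj E. \<forall>u\<in>Arr B. Cod B u = fob P Y \<longrightarrow> (\<exists>f. cartesian_lift E B P Y u f))"

definition cleavage ::
  "('o, 'a) cat \<Rightarrow> ('p, 'b) cat \<Rightarrow> ('o, 'a, 'p, 'b) func \<Rightarrow> ('o \<Rightarrow> 'b \<Rightarrow> 'a) \<Rightarrow> bool" where
  "cleavage E B P \<kappa> \<longleftrightarrow>
     (\<forall>Y\<in>Obj E. \<forall>u\<in>Arr B. Cod B u = fob P Y \<longrightarrow> cartesian_lift E B P Y u (\<kappa> Y u))"

text \<open>\<open>H\<close> is the functor between total categories, \<open>K\<close> the one between bases.\<close>

definition cleavage_preserving ::
  "('o, 'a) cat \<Rightarrow> ('p, 'b) cat \<Rightarrow> ('o, 'a, 'p, 'b) func \<Rightarrow> ('o \<Rightarrow> 'b \<Rightarrow> 'a) \<Rightarrow>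
   ('q \<Rightarrow> 'd \<Rightarrow> 'c) \<Rightarrow> ('o, 'a, 'q, 'c) func \<Rightarrow> ('p, 'b, 'r, 'd) func \<Rightarrow> bool" where
  "cleavage_preserving E B P \<kappa> \<kappa>' H K \<longleftrightarrow>
     (\<forall>Y\<in>Obj E. \<forall>u\<in>Arr B. Cod B u = fob P Y \<longrightarrow> far H (\<kappa> Y u) = \<kappa>' (fob H Y) (far K u))"

definition cartesian_preserving ::
  "('o, 'a) cat \<Rightarrow> ('p, 'b) cat \<Rightarrow> ('o, 'a, 'p, 'b) func \<Rightarrow>
   ('q, 'c) cat \<Rightarrow> ('r, 'd) cat \<Rightarrow> ('q, 'c, 'r, 'd) func \<Rightarrow> ('o, 'a, 'q, 'c) func \<Rightarrow> bool" where
  "cartesian_preserving E B P E' B' P' H \<longleftrightarrow>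
     (\<forall>f. cartesian E B P f \<longrightarrow> cartesian E' B' P' (far H f))"


section \<open>2-categories and 2-functors\<close>

text \<open>\<open>Und\<close> is the underlying category; \<open>Ver\<close> is the disjoint union of all hom-categories: its
  objects are the arrows, its arrows the 2-cells, and its composition is vertical composition.\<close>

record ('o, 'a, 'c) two_cat =
  Und :: "('o, 'a) cat"
  Ver :: "('a, 'c) cat"
  HCmp :: "'c \<Rightarrow> 'c \<Rightarrow> 'c"  (infixr "\<star>\<index>" 70)

definition hom_cat :: "('o, 'a, 'c) two_cat \<Rightarrow> 'o \<Rightarrow> 'o \<Rightarrow> ('a, 'c) cat" where
  "hom_cat K X Y = (Ver K)\<lparr>
     Obj := hom (Und K) X Y,
     Arr := {\<theta> \<in> Arr (Ver K). Dom (Ver K) \<theta> \<in> hom (Und K) X Y \<and> Cod (Ver K) \<theta> \<in> hom (Und K) X Y}\<rparr>"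

locale two_category =
  U: category "Und K" + V: category "Ver K"
  for K :: "('o, 'a, 'c) two_cat" (structure) +
  assumes Obj_Ver: "Obj (Ver K) = Arr (Und K)"
    and parallel_Dom: "\<theta> \<in> Arr (Ver K)
      \<Longrightarrow> Dom (Und K) (Dom (Ver K) \<theta>) = Dom (Und K) (Cod (Ver K) \<theta>)"
    and parallel_Cod: "\<theta> \<in> Arr (Ver K)
      \<Longrightarrow> Cod (Und K) (Dom (Ver K) \<theta>) = Cod (Und K) (Cod (Ver K) \<theta>)"
    and HCmp_in_hom: "\<theta> \<in> Arr (hom_cat K X Y) \<Longrightarrow> \<phi> \<in> Arr (hom_cat K Y Z)
      \<Longrightarrow> \<theta> \<in> hom (Ver K) f g \<Longrightarrow> \<phi> \<in> hom (Ver K) h k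
      \<Longrightarrow> \<phi> \<star> \<theta> \<in> hom (Ver K) (h \<cdot>\<^bsub>Und K\<^esub> f) (k \<cdot>\<^bsub>Und K\<^esub> g)"
    and HCmp_Idn: "f \<in> hom (Und K) X Y \<Longrightarrow> h \<in> hom (Und K) Y Z
      \<Longrightarrow> Idn (Ver K) h \<star> Idn (Ver K) f = Idn (Ver K) (h \<cdot>\<^bsub>Und K\<^esub> f)"
    and interchange: "\<theta> \<in> Arr (hom_cat K X Y) \<Longrightarrow> \<theta>' \<in> Arr (hom_cat K X Y)
      \<Longrightarrow> \<phi> \<in> Arr (hom_cat K Y Z) \<Longrightarrow> \<phi>' \<in> Arr (hom_cat K Y Z)
      \<Longrightarrow> Dom (Ver K) \<theta>' = Cod (Ver K) \<theta> \<Longrightarrow> Dom (Ver K) \<phi>' = Cod (Ver K) \<phi>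
      \<Longrightarrow> (\<phi>' \<cdot>\<^bsub>Ver K\<^esub> \<phi>) \<star> (\<theta>' \<cdot>\<^bsub>Ver K\<^esub> \<theta>) = (\<phi>' \<star> \<theta>') \<cdot>\<^bsub>Ver K\<^esub> (\<phi> \<star> \<theta>)"
    and HCmp_assoc: "\<theta> \<in> Arr (hom_cat K W X) \<Longrightarrow> \<phi> \<in> Arr (hom_cat K X Y)
      \<Longrightarrow> \<psi> \<in> Arr (hom_cat K Y Z) \<Longrightarrow> (\<psi> \<star> \<phi>) \<star> \<theta> = \<psi> \<star> (\<phi> \<star> \<theta>)"
    and HCmp_unit_right: "\<theta> \<in> Arr (hom_cat K X Y)
      \<Longrightarrow> \<theta> \<star> Idn (Ver K) (Idn (Und K) X) = \<theta>"
    and HCmp_unit_left: "\<theta> \<in> Arr (hom_cat K X Y)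
      \<Longrightarrow> Idn (Ver K) (Idn (Und K) Y) \<star> \<theta> = \<theta>"

record ('o, 'a, 'c, 'p, 'b, 'd) two_func =
  on0 :: "'o \<Rightarrow> 'p"
  on1 :: "'a \<Rightarrow> 'b"
  on2 :: "'c \<Rightarrow> 'd"

definition und_func :: "('o, 'a, 'c, 'p, 'b, 'd) two_func \<Rightarrow> ('o, 'a, 'p, 'b) func" where
  "und_func P = \<lparr>fob = on0 P, far = on1 P\<rparr>"

text \<open>The action on all hom-categories at once; restricted to \<open>hom_cat E X Y\<close> it is the local
  functor from E(X,Y) to B(PX,PY).\<close>

definition loc_func :: "('o, 'a, 'c, 'p, 'b, 'd) two_func \<Rightarrow> ('a, 'c, 'b, 'd) func" where
  "loc_func P = \<lparr>fob = on1 P, far = on2 P\<rparr>"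

locale two_functor =
  E: two_category E + B: two_category B +
  U: cat_functor "Und E" "Und B" "und_func P" +
  V: cat_functor "Ver E" "Ver B" "loc_func P"
  for E :: "('o, 'a, 'c) two_cat" and B :: "('p, 'b, 'd) two_cat"
    and P :: "('o, 'a, 'c, 'p, 'b, 'd) two_func" +
  assumes on2_HCmp: "\<theta> \<in> Arr (hom_cat E X Y) \<Longrightarrow> \<phi> \<in> Arr (hom_cat E Y Z)
      \<Longrightarrow> on2 P (\<phi> \<star>\<^bsub>E\<^esub> \<theta>) = on2 P \<phi> \<star>\<^bsub>B\<^esub> on2 P \<theta>"


section \<open>2-fibrations\<close>

text \<open>In the second clause \<open>h'\<close> and \<open>l'\<close> are the lifts of \<open>h\<close> and \<open>l\<close> given by the first clause;
  there, \<open>P\<theta> = Pf * \<gamma>\<close> forces \<open>Pg = Pf \<cdot> h\<close> and \<open>Pk = Pf \<cdot> l\<close>.\<close>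

definition two_cartesian ::
  "('o, 'a, 'c) two_cat \<Rightarrow> ('p, 'b, 'd) two_cat \<Rightarrow> ('o, 'a, 'c, 'p, 'b, 'd) two_func
   \<Rightarrow> 'a \<Rightarrow> bool" where
  "two_cartesian E B P f \<longleftrightarrow>
     cartesian (Und E) (Und B) (und_func P) f \<and>
     (\<forall>Z\<in>Obj (Und E). \<forall>X Y. f \<in> hom (Und E) X Y \<longrightarrow>
       (\<forall>g\<in>hom (Und E) Z Y. \<forall>k\<in>hom (Und E) Z Y. \<forall>\<theta>\<in>hom (Ver E) g k.
        \<forall>h\<in>hom (Und B) (on0 P Z) (on0 P X). \<forall>l\<in>hom (Und B) (on0 P Z) (on0 P X).
        \<forall>\<gamma>\<in>hom (Ver B) h l.
          on2 P \<theta> = Idn (Ver B) (on1 P f) \<star>\<^bsub>B\<^esub> \<gamma> \<longrightarrow>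
          (\<forall>h'\<in>hom (Und E) Z X. \<forall>l'\<in>hom (Und E) Z X.
             on1 P h' = h \<and> f \<cdot>\<^bsub>Und E\<^esub> h' = g \<and> on1 P l' = l \<and> f \<cdot>\<^bsub>Und E\<^esub> l' = k \<longrightarrow>
             (\<exists>!\<gamma>'. \<gamma>' \<in> hom (Ver E) h' l' \<and> on2 P \<gamma>' = \<gamma> \<and> Idn (Ver E) f \<star>\<^bsub>E\<^esub> \<gamma>' = \<theta>))))"

definition two_cartesian_lift ::
  "('o, 'a, 'c) two_cat \<Rightarrow> ('p, 'b, 'd) two_cat \<Rightarrow> ('o, 'a, 'c, 'p, 'b, 'd) two_func
   \<Rightarrow> 'o \<Rightarrow> 'b \<Rightarrow> 'a \<Rightarrow> bool" where
  "two_cartesian_lift E B P Y u f \<longleftrightarrow>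
     two_cartesian E B P f \<and> Cod (Und E) f = Y \<and> on1 P f = u"

definition cartesian_two_cell ::
  "('o, 'a, 'c) two_cat \<Rightarrow> ('p, 'b, 'd) two_cat \<Rightarrow> ('o, 'a, 'c, 'p, 'b, 'd) two_func
   \<Rightarrow> 'o \<Rightarrow> 'o \<Rightarrow> 'c \<Rightarrow> bool" where
  "cartesian_two_cell E B P X Y \<theta> \<longleftrightarrow>
     cartesian (hom_cat E X Y) (hom_cat B (on0 P X) (on0 P Y)) (loc_func P) \<theta>"

definition two_fibration ::
  "('o, 'a, 'c) two_cat \<Rightarrow> ('p, 'b, 'd) two_cat \<Rightarrow> ('o, 'a, 'c, 'p, 'b, 'd) two_func
   \<Rightarrow> bool" where
  "two_fibration E B P \<longleftrightarrow> two_functor E B P \<and>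
     (\<forall>Y\<in>Obj (Und E). \<forall>u\<in>Arr (Und B). Cod (Und B) u = on0 P Y \<longrightarrow>
        (\<exists>f. two_cartesian_lift E B P Y u f)) \<and>
     (\<forall>X\<in>Obj (Und E). \<forall>Y\<in>Obj (Und E).
        fibration (hom_cat E X Y) (hom_cat B (on0 P X) (on0 P Y)) (loc_func P)) \<and>
     (\<forall>X\<in>Obj (Und E). \<forall>Y\<in>Obj (Und E). \<forall>Z\<in>Obj (Und E). \<forall>\<theta> \<phi>.
        cartesian_two_cell E B P X Y \<theta> \<and> cartesian_two_cell E B P Y Z \<phi> \<longrightarrow>
        cartesian_two_cell E B P X Z (\<phi> \<star>\<^bsub>E\<^esub> \<theta>))"

text \<open>Being cloven is existence of the two choices, so that it is a property of \<open>P\<close>.\<close>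

definition cloven_two_fibration ::
  "('o, 'a, 'c) two_cat \<Rightarrow> ('p, 'b, 'd) two_cat \<Rightarrow> ('o, 'a, 'c, 'p, 'b, 'd) two_func
   \<Rightarrow> bool" where
  "cloven_two_fibration E B P \<longleftrightarrow> two_fibration E B P \<and>
     (\<exists>\<kappa>. \<forall>Y\<in>Obj (Und E). \<forall>u\<in>Arr (Und B). Cod (Und B) u = on0 P Y \<longrightarrow>
        two_cartesian_lift E B P Y u (\<kappa> Y u)) \<and>
     (\<exists>\<kappa>. \<forall>X\<in>Obj (Und E). \<forall>Y\<in>Obj (Und E).
        cleavage (hom_cat E X Y) (hom_cat B (on0 P X) (on0 P Y)) (loc_func P) (\<kappa> X Y))"


section \<open>Double categories and double fibrations\<close>

text \<open>Double categories are taken strict, which is all that quintets require. An externally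
  composable pair is written in diagrammatic order: \<open>Ten D\<close> sends a pair \<open>(m, n)\<close> with
  \<open>tgt m = src n\<close> to the external composite of \<open>m\<close> followed by \<open>n\<close>.\<close>

record ('o, 'a, 'p, 'c) double_cat =
  D0 :: "('o, 'a) cat"
  D1 :: "('p, 'c) cat"
  Src :: "('p, 'c, 'o, 'a) func"
  Tgt :: "('p, 'c, 'o, 'a) func"
  Unt :: "('o, 'a, 'p, 'c) func"
  Ten :: "('p \<times> 'p, 'c \<times> 'c, 'p, 'c) func"

text \<open>The pullback of \<open>Tgt D\<close> along \<open>Src D\<close>.\<close>

definition composables :: "('o, 'a, 'p, 'c) double_cat \<Rightarrow> ('p \<times> 'p, 'c \<times> 'c) cat" where
  "composables D = \<lparr>
     Obj = {(m, n). m \<in> Obj (D1 D) \<and> n \<in> Obj (D1 D) \<and> fob (Tgt D) m = fob (Src D) n},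
     Arr = {(\<alpha>, \<beta>). \<alpha> \<in> Arr (D1 D) \<and> \<beta> \<in> Arr (D1 D) \<and> far (Tgt D) \<alpha> = far (Src D) \<beta>},
     Dom = map_prod (Dom (D1 D)) (Dom (D1 D)),
     Cod = map_prod (Cod (D1 D)) (Cod (D1 D)),
     Idn = map_prod (Idn (D1 D)) (Idn (D1 D)),
     Cmp = (\<lambda>(\<alpha>', \<beta>') (\<alpha>, \<beta>). (\<alpha>' \<cdot>\<^bsub>D1 D\<^esub> \<alpha>, \<beta>' \<cdot>\<^bsub>D1 D\<^esub> \<beta>))\<rparr>"

locale double_category =
  O: category "D0 D" + M: category "D1 D" +
  S: cat_functor "D1 D" "D0 D" "Src D" + T: cat_functor "D1 D" "D0 D" "Tgt D" +
  Y: cat_functor "D0 D" "D1 D" "Unt D" + X: cat_functor "composables D" "D1 D" "Ten D"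
  for D :: "('o, 'a, 'p, 'c) double_cat" +
  assumes Src_Unt: "A \<in> Obj (D0 D) \<Longrightarrow> fob (Src D) (fob (Unt D) A) = A"
      "f \<in> Arr (D0 D) \<Longrightarrow> far (Src D) (far (Unt D) f) = f"
    and Tgt_Unt: "A \<in> Obj (D0 D) \<Longrightarrow> fob (Tgt D) (fob (Unt D) A) = A"
      "f \<in> Arr (D0 D) \<Longrightarrow> far (Tgt D) (far (Unt D) f) = f"
    and Src_Ten: "(m, n) \<in> Obj (composables D)
        \<Longrightarrow> fob (Src D) (fob (Ten D) (m, n)) = fob (Src D) m"
      "(\<alpha>, \<beta>) \<in> Arr (composables D) \<Longrightarrow> far (Src D) (far (Ten D) (\<alpha>, \<beta>)) = far (Src D) \<alpha>"
    and Tgt_Ten: "(m, n) \<in> Obj (composables D)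
        \<Longrightarrow> fob (Tgt D) (fob (Ten D) (m, n)) = fob (Tgt D) n"
      "(\<alpha>, \<beta>) \<in> Arr (composables D) \<Longrightarrow> far (Tgt D) (far (Ten D) (\<alpha>, \<beta>)) = far (Tgt D) \<beta>"
    and Ten_unit_left: "m \<in> Obj (D1 D)
        \<Longrightarrow> fob (Ten D) (fob (Unt D) (fob (Src D) m), m) = m"
      "\<alpha> \<in> Arr (D1 D) \<Longrightarrow> far (Ten D) (far (Unt D) (far (Src D) \<alpha>), \<alpha>) = \<alpha>"
    and Ten_unit_right: "m \<in> Obj (D1 D)
        \<Longrightarrow> fob (Ten D) (m, fob (Unt D) (fob (Tgt D) m)) = m"
      "\<alpha> \<in> Arr (D1 D) \<Longrightarrow> far (Ten D) (\<alpha>, far (Unt D) (far (Tgt D) \<alpha>)) = \<alpha>"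
    and Ten_assoc: "(m, n) \<in> Obj (composables D) \<Longrightarrow> (n, p) \<in> Obj (composables D)
        \<Longrightarrow> fob (Ten D) (fob (Ten D) (m, n), p) = fob (Ten D) (m, fob (Ten D) (n, p))"
      "(\<alpha>, \<beta>) \<in> Arr (composables D) \<Longrightarrow> (\<beta>, \<gamma>) \<in> Arr (composables D)
        \<Longrightarrow> far (Ten D) (far (Ten D) (\<alpha>, \<beta>), \<gamma>) = far (Ten D) (\<alpha>, far (Ten D) (\<beta>, \<gamma>))"

record ('o, 'a, 'p, 'c, 'o2, 'a2, 'p2, 'c2) double_func =
  F0 :: "('o, 'a, 'o2, 'a2) func"
  F1 :: "('p, 'c, 'p2, 'c2) func"

definition composables_func ::
  "('o, 'a, 'p, 'c, 'o2, 'a2, 'p2, 'c2) double_func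
   \<Rightarrow> ('p \<times> 'p, 'c \<times> 'c, 'p2 \<times> 'p2, 'c2 \<times> 'c2) func" where
  "composables_func P = \<lparr>fob = map_prod (fob (F1 P)) (fob (F1 P)),
                         far = map_prod (far (F1 P)) (far (F1 P))\<rparr>"

locale strict_double_functor =
  E: double_category E + B: double_category B +
  P0: cat_functor "D0 E" "D0 B" "F0 P" + P1: cat_functor "D1 E" "D1 B" "F1 P"
  for E :: "('o, 'a, 'p, 'c) double_cat" and B :: "('o2, 'a2, 'p2, 'c2) double_cat"
    and P :: "('o, 'a, 'p, 'c, 'o2, 'a2, 'p2, 'c2) double_func" +
  assumes P_Src: "m \<in> Obj (D1 E) \<Longrightarrow> fob (F0 P) (fob (Src E) m) = fob (Src B) (fob (F1 P) m)"
      "\<alpha> \<in> Arr (D1 E) \<Longrightarrow> far (F0 P) (far (Src E) \<alpha>) = far (Src B) (far (F1 P) \<alpha>)"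
    and P_Tgt: "m \<in> Obj (D1 E) \<Longrightarrow> fob (F0 P) (fob (Tgt E) m) = fob (Tgt B) (fob (F1 P) m)"
      "\<alpha> \<in> Arr (D1 E) \<Longrightarrow> far (F0 P) (far (Tgt E) \<alpha>) = far (Tgt B) (far (F1 P) \<alpha>)"
    and P_Unt: "A \<in> Obj (D0 E) \<Longrightarrow> fob (F1 P) (fob (Unt E) A) = fob (Unt B) (fob (F0 P) A)"
      "f \<in> Arr (D0 E) \<Longrightarrow> far (F1 P) (far (Unt E) f) = far (Unt B) (far (F0 P) f)"
    and P_Ten: "(m, n) \<in> Obj (composables E)
        \<Longrightarrow> fob (F1 P) (fob (Ten E) (m, n)) = fob (Ten B) (fob (F1 P) m, fob (F1 P) n)"
      "(\<alpha>, \<beta>) \<in> Arr (composables E)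
        \<Longrightarrow> far (F1 P) (far (Ten E) (\<alpha>, \<beta>)) = far (Ten B) (far (F1 P) \<alpha>, far (F1 P) \<beta>)"

text \<open>For the external composition, Cartesian arrows of the pullback category are those for the
  functor induced by \<open>P\<close> between the pullbacks.\<close>

definition double_fibration ::
  "('o, 'a, 'p, 'c) double_cat \<Rightarrow> ('o2, 'a2, 'p2, 'c2) double_cat
   \<Rightarrow> ('o, 'a, 'p, 'c, 'o2, 'a2, 'p2, 'c2) double_func \<Rightarrow> bool" where
  "double_fibration E B P \<longleftrightarrow> strict_double_functor E B P \<and>
     fibration (D0 E) (D0 B) (F0 P) \<and> fibration (D1 E) (D1 B) (F1 P) \<and>
     (\<exists>\<kappa>0 \<kappa>1. cleavage (D0 E) (D0 B) (F0 P) \<kappa>0 \<and> cleavage (D1 E) (D1 B) (F1 P) \<kappa>1 \<and>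
        cleavage_preserving (D1 E) (D1 B) (F1 P) \<kappa>1 \<kappa>0 (Src E) (Src B) \<and>
        cleavage_preserving (D1 E) (D1 B) (F1 P) \<kappa>1 \<kappa>0 (Tgt E) (Tgt B)) \<and>
     cartesian_preserving (D0 E) (D0 B) (F0 P) (D1 E) (D1 B) (F1 P) (Unt E) \<and>
     cartesian_preserving (composables E) (composables B) (composables_func P)
       (D1 E) (D1 B) (F1 P) (Ten E)"


section \<open>Quintets\<close>

text \<open>\<open>Quintet m n f g \<theta>\<close> is the cell with internal domain \<open>m\<close>, internal codomain \<open>n\<close>, external
  source \<open>f\<close>, external target \<open>g\<close> and underlying 2-cell \<open>\<theta>\<close> from \<open>g \<cdot> m\<close> to \<open>n \<cdot> f\<close>.\<close>

datatype ('a, 'c) quintet =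
  Quintet (idom: 'a) (icod: 'a) (esrc: 'a) (etgt: 'a) (cell: 'c)

definition quintet_cells :: "('o, 'a, 'c) two_cat \<Rightarrow> ('a, 'c) quintet set" where
  "quintet_cells K = {Quintet m n f g \<theta> | m n f g \<theta>. \<exists>A B C D.
     m \<in> hom (Und K) A B \<and> n \<in> hom (Und K) C D \<and> f \<in> hom (Und K) A C \<and> g \<in> hom (Und K) B D \<and>
     \<theta> \<in> hom (Ver K) (g \<cdot>\<^bsub>Und K\<^esub> m) (n \<cdot>\<^bsub>Und K\<^esub> f)}"

text \<open>Internal composition pastes \<open>\<theta> : g m \<Rightarrow> n f\<close> and \<open>\<theta>' : g' n \<Rightarrow> n' f'\<close> to
  \<open>g' g m \<Rightarrow> g' n f \<Rightarrow> n' f' f\<close>.\<close>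

definition quintet_cat :: "('o, 'a, 'c) two_cat \<Rightarrow> ('a, ('a, 'c) quintet) cat" where
  "quintet_cat K = \<lparr>
     Obj = Arr (Und K),
     Arr = quintet_cells K,
     Dom = idom,
     Cod = icod,
     Idn = (\<lambda>m. Quintet m m (Idn (Und K) (Dom (Und K) m)) (Idn (Und K) (Cod (Und K) m))
                  (Idn (Ver K) m)),
     Cmp = (\<lambda>\<beta> \<alpha>. Quintet (idom \<alpha>) (icod \<beta>)
                  (esrc \<beta> \<cdot>\<^bsub>Und K\<^esub> esrc \<alpha>) (etgt \<beta> \<cdot>\<^bsub>Und K\<^esub> etgt \<alpha>)
                  ((cell \<beta> \<star>\<^bsub>K\<^esub> Idn (Ver K) (esrc \<alpha>)) \<cdot>\<^bsub>Ver K\<^esub>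
                   (Idn (Ver K) (etgt \<beta>) \<star>\<^bsub>K\<^esub> cell \<alpha>)))\<rparr>"

text \<open>External composition pastes \<open>\<theta> : g m \<Rightarrow> n f\<close> and \<open>\<theta>' : h m' \<Rightarrow> n' g\<close> to
  \<open>h m' m \<Rightarrow> n' g m \<Rightarrow> n' n f\<close>.\<close>

definition quintets ::
  "('o, 'a, 'c) two_cat \<Rightarrow> ('o, 'a, 'a, ('a, 'c) quintet) double_cat" where
  "quintets K = \<lparr>
     D0 = Und K,
     D1 = quintet_cat K,
     Src = \<lparr>fob = Dom (Und K), far = esrc\<rparr>,
     Tgt = \<lparr>fob = Cod (Und K), far = etgt\<rparr>,
     Unt = \<lparr>fob = Idn (Und K),
            far = (\<lambda>f. Quintet (Idn (Und K) (Dom (Und K) f)) (Idn (Und K) (Cod (Und K) f)) f f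
                         (Idn (Ver K) f))\<rparr>,
     Ten = \<lparr>fob = (\<lambda>(m, m'). m' \<cdot>\<^bsub>Und K\<^esub> m),
            far = (\<lambda>(\<alpha>, \<beta>). Quintet (idom \<beta> \<cdot>\<^bsub>Und K\<^esub> idom \<alpha>) (icod \<beta> \<cdot>\<^bsub>Und K\<^esub> icod \<alpha>)
                         (esrc \<alpha>) (etgt \<beta>)
                         ((Idn (Ver K) (icod \<beta>) \<star>\<^bsub>K\<^esub> cell \<alpha>) \<cdot>\<^bsub>Ver K\<^esub>
                          (cell \<beta> \<star>\<^bsub>K\<^esub> Idn (Ver K) (idom \<alpha>))))\<rparr>\<rparr>"

definition quintets_func ::
  "('o, 'a, 'c, 'p, 'b, 'd) two_func
   \<Rightarrow> ('o, 'a, 'a, ('a, 'c) quintet, 'p, 'b, 'b, ('b, 'd) quintet) double_func" where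
  "quintets_func P = \<lparr>F0 = und_func P, F1 = \<lparr>fob = on1 P, far = map_quintet (on1 P) (on2 P)\<rparr>\<rparr>"

end

theory Submission
  imports Defs
begin

text \<open>For a 2-fibration, a quintet is Cartesian as soon as its external source and target are
  Cartesian and its 2-cell is Cartesian in its hom-category. To lift a quintet \<open>g m \<Rightarrow> n f\<close> over \<open>n\<close>,
  choose lifts of \<open>f\<close> and \<open>g\<close>, lift the 2-cell in a hom-category, and factor its domain through the
  lift of \<open>g\<close>; such lifts are compatible with the cleavage of arrows, and any Cartesian quintet
  differs from one of them by an isomorphism. Conversely, 2-cells are quintets with identity external
  source and target. Such a quintet is Cartesian exactly when its 2-cell is Cartesian in its
  hom-category, and the external composite of two of them is the horizontal composite.\<close>

section \<open>Cartesian arrows\<close>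

text \<open>A Cartesian lift in the category of quintets alone says nothing about its external
  boundary. It is the preservation of cleavages by \<open>Src\<close> and \<open>Tgt\<close> that
  makes this boundary Cartesian, and hence invertible when it lies over identities. In the other
  direction, the same requirement means that a single cleavage of arrows must supply both sides of
  every lifted quintet. Preservation of Cartesian arrows by the external unit corresponds to the
  second clause of 2-Cartesian arrows: the unit on \<open>f\<close> carries an identity 2-cell, and
  factoring through it lifts 2-cells between composites with \<open>f\<close>. Preservation by
  external composition corresponds to closure of Cartesian 2-cells under horizontal composition. The
  obstacle on the composition side is that a Cartesian arrow of the pullback category is not known
  to have Cartesian components. Pairs of Cartesian quintets are Cartesian once their shared arrow
  is, so preservation is checked on pairs of chosen lifts and then transported to an arbitrary
  Cartesian pair.\<close>

lemma hom_iff: "f \<in> hom C X Y \<longleftrightarrow> f \<in> Arr C \<and> Dom C f = X \<and> Cod C f = Y"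
  by (auto simp: hom_def)

context category
begin

declare Dom_in_Obj [simp] Cod_in_Obj [simp]

lemma Idn_simps [simp]:
  assumes "X \<in> Obj C"
  shows "Idn C X \<in> Arr C" "Dom C (Idn C X) = X" "Cod C (Idn C X) = X"
  using Idn_in_hom[OF assms] by (auto simp: hom_iff)

lemma Cmp_simps [simp]:
  assumes "f \<in> Arr C" "g \<in> Arr C" "Dom C g = Cod C f"
  shows "g \<cdot> f \<in> Arr C" "Dom C (g \<cdot> f) = Dom C f" "Cod C (g \<cdot> f) = Cod C g"
  using Cmp_in_hom[of f "Dom C f" "Cod C f" g "Cod C g"] assms by (auto simp: hom_iff)

lemma Cmp_unit [simp]:
  "f \<in> Arr C \<Longrightarrow> Dom C f = X \<Longrightarrow> f \<cdot> Idn C X = f"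
  "f \<in> Arr C \<Longrightarrow> Cod C f = X \<Longrightarrow> Idn C X \<cdot> f = f"
  using Cmp_Idn Idn_Cmp by (auto simp: hom_iff)

lemma Cmp_ac:
  "f \<in> Arr C \<Longrightarrow> g \<in> Arr C \<Longrightarrow> h \<in> Arr C \<Longrightarrow> Dom C g = Cod C f \<Longrightarrow> Dom C h = Cod C g
    \<Longrightarrow> (h \<cdot> g) \<cdot> f = h \<cdot> (g \<cdot> f)"
  using Cmp_assoc by (auto simp: hom_iff)

end

context cat_functor
begin

declare fob_in_Obj [simp] far_Idn [simp]

lemma far_simps [simp]:
  assumes "f \<in> Arr C"
  shows "far F f \<in> Arr D" "Dom D (far F f) = fob F (Dom C f)" "Cod D (far F f) = fob F (Cod C f)"
  using far_in_hom[of f "Dom C f" "Cod C f"] assms by (auto simp: hom_iff)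

lemma far_Cmp_Arr [simp]:
  "f \<in> Arr C \<Longrightarrow> g \<in> Arr C \<Longrightarrow> Dom C g = Cod C f
    \<Longrightarrow> far F (g \<cdot>\<^bsub>C\<^esub> f) = far F g \<cdot>\<^bsub>D\<^esub> far F f"
  using far_Cmp by (auto simp: hom_iff)

lemma cartesianI:
  assumes "f \<in> Arr C"
    and "\<And>g h. \<lbrakk>g \<in> Arr C; Cod C g = Cod C f; h \<in> Arr D; Dom D h = fob F (Dom C g);
        Cod D h = fob F (Dom C f); far F f \<cdot>\<^bsub>D\<^esub> h = far F g\<rbrakk>
      \<Longrightarrow> \<exists>k. k \<in> Arr C \<and> Dom C k = Dom C g \<and> Cod C k = Dom C f \<and> far F k = h \<and> f \<cdot>\<^bsub>C\<^esub> k = g"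
    and "\<And>k k'. \<lbrakk>k \<in> Arr C; k' \<in> Arr C; Dom C k = Dom C k'; Cod C k = Dom C f; Cod C k' = Dom C f;
        far F k = far F k'; f \<cdot>\<^bsub>C\<^esub> k = f \<cdot>\<^bsub>C\<^esub> k'\<rbrakk> \<Longrightarrow> k = k'"
  shows "cartesian C D F f"
  unfolding cartesian_def
proof (intro conjI ballI impI)
  fix Z g h
  assume g: "g \<in> hom C Z (Cod C f)" and h: "h \<in> hom D (fob F Z) (fob F (Dom C f))"
    and eq: "far F f \<cdot>\<^bsub>D\<^esub> h = far F g"
  show "\<exists>!k. k \<in> hom C Z (Dom C f) \<and> far F k = h \<and> f \<cdot>\<^bsub>C\<^esub> k = g"
  proof (rule ex_ex1I)
    show "\<exists>k. k \<in> hom C Z (Dom C f) \<and> far F k = h \<and> f \<cdot>\<^bsub>C\<^esub> k = g"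
      using assms(2)[of g h] g h eq by (auto simp: hom_iff)
  qed (rule assms(3); simp add: hom_iff)
qed (fact assms(1))

lemma cartesian_Arr: "cartesian C D F f \<Longrightarrow> f \<in> Arr C"
  by (simp add: cartesian_def)

lemma cartesian_factor:
  assumes "cartesian C D F f" "g \<in> Arr C" "Cod C g = Cod C f" "h \<in> Arr D"
    "Dom D h = fob F (Dom C g)" "Cod D h = fob F (Dom C f)" "far F f \<cdot>\<^bsub>D\<^esub> h = far F g"
  shows "\<exists>k. k \<in> Arr C \<and> Dom C k = Dom C g \<and> Cod C k = Dom C f \<and> far F k = h \<and> f \<cdot>\<^bsub>C\<^esub> k = g"
proof -
  have "Dom C g \<in> Obj C" "g \<in> hom C (Dom C g) (Cod C f)"
    "h \<in> hom D (fob F (Dom C g)) (fob F (Dom C f))"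
    using assms by (auto simp: hom_iff)
  then have "\<exists>k. k \<in> hom C (Dom C g) (Dom C f) \<and> far F k = h \<and> f \<cdot>\<^bsub>C\<^esub> k = g"
    using assms(1,7) unfolding cartesian_def by blast
  then show ?thesis by (auto simp: hom_iff)
qed

lemma cartesian_cancel:
  assumes f: "cartesian C D F f" and k: "k \<in> Arr C" "k' \<in> Arr C" "Dom C k = Dom C k'"
    "Cod C k = Dom C f" "Cod C k' = Dom C f" "far F k = far F k'" "f \<cdot>\<^bsub>C\<^esub> k = f \<cdot>\<^bsub>C\<^esub> k'"
  shows "k = k'"
proof -
  have fA: "f \<in> Arr C" using f by (rule cartesian_Arr)
  have "Dom C k \<in> Obj C" "f \<cdot>\<^bsub>C\<^esub> k \<in> hom C (Dom C k) (Cod C f)"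
    "far F k \<in> hom D (fob F (Dom C k)) (fob F (Dom C f))"
    "far F f \<cdot>\<^bsub>D\<^esub> far F k = far F (f \<cdot>\<^bsub>C\<^esub> k)"
    using fA k by (auto simp: hom_iff)
  then have "\<exists>!m. m \<in> hom C (Dom C k) (Dom C f) \<and> far F m = far F k \<and> f \<cdot>\<^bsub>C\<^esub> m = f \<cdot>\<^bsub>C\<^esub> k"
    using f unfolding cartesian_def by blast
  moreover have "k \<in> hom C (Dom C k) (Dom C f)" "k' \<in> hom C (Dom C k) (Dom C f)"
    using k by (auto simp: hom_iff)
  ultimately show ?thesis using k by metis
qed

text \<open>The only possible factorization of \<open>g\<close> is \<open>j \<cdot> g\<close>, and
  its image is \<open>h\<close> because functors preserve the inverse laws. Applied both to
  comparison arrows between lifts and to invertible quintets.\<close>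

lemma cartesian_iso:
  assumes i: "i \<in> Arr C" "j \<in> Arr C" "Dom C i = Cod C j" "Cod C i = Dom C j"
    "i \<cdot>\<^bsub>C\<^esub> j = Idn C (Dom C j)" "j \<cdot>\<^bsub>C\<^esub> i = Idn C (Dom C i)"
  shows "cartesian C D F i"
proof (rule cartesianI)
  fix g h
  assume g: "g \<in> Arr C" "Cod C g = Cod C i" "h \<in> Arr D" "Dom D h = fob F (Dom C g)"
    "Cod D h = fob F (Dom C i)" "far F i \<cdot>\<^bsub>D\<^esub> h = far F g"
  have "far F (j \<cdot>\<^bsub>C\<^esub> g) = far F j \<cdot>\<^bsub>D\<^esub> (far F i \<cdot>\<^bsub>D\<^esub> h)" using g i by simp
  also have "\<dots> = far F (j \<cdot>\<^bsub>C\<^esub> i) \<cdot>\<^bsub>D\<^esub> h" using g i(1-4) by (simp add: D.Cmp_ac)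
  also have "\<dots> = h" using g i by simp
  finally have "far F (j \<cdot>\<^bsub>C\<^esub> g) = h" .
  moreover have "i \<cdot>\<^bsub>C\<^esub> (j \<cdot>\<^bsub>C\<^esub> g) = g" using g i by (simp add: C.Cmp_ac[symmetric])
  ultimately show "\<exists>k. k \<in> Arr C \<and> Dom C k = Dom C g \<and> Cod C k = Dom C i \<and> far F k = h
      \<and> i \<cdot>\<^bsub>C\<^esub> k = g"
    using g i by (intro exI[of _ "j \<cdot>\<^bsub>C\<^esub> g"]) simp
next
  fix k k'
  assume k: "k \<in> Arr C" "k' \<in> Arr C" "Cod C k = Dom C i" "Cod C k' = Dom C i"
    "i \<cdot>\<^bsub>C\<^esub> k = i \<cdot>\<^bsub>C\<^esub> k'"
  then have "(j \<cdot>\<^bsub>C\<^esub> i) \<cdot>\<^bsub>C\<^esub> k = (j \<cdot>\<^bsub>C\<^esub> i) \<cdot>\<^bsub>C\<^esub> k'"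
    using i(1-4) by (simp add: C.Cmp_ac)
  then show "k = k'" using i k by simp
qed (fact i(1))

lemma cartesian_Idn: "X \<in> Obj C \<Longrightarrow> cartesian C D F (Idn C X)"
  by (rule cartesian_iso[of _ "Idn C X"]) auto

lemma cartesian_Cmp:
  assumes f: "cartesian C D F f" and g: "cartesian C D F g" and gf: "Dom C g = Cod C f"
  shows "cartesian C D F (g \<cdot>\<^bsub>C\<^esub> f)"
proof (rule cartesianI)
  note A [simp] = f[THEN cartesian_Arr] g[THEN cartesian_Arr]
  show "g \<cdot>\<^bsub>C\<^esub> f \<in> Arr C" using gf by simp
  fix u h
  assume u: "u \<in> Arr C" "Cod C u = Cod C (g \<cdot>\<^bsub>C\<^esub> f)" "h \<in> Arr D" "Dom D h = fob F (Dom C u)"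
    "Cod D h = fob F (Dom C (g \<cdot>\<^bsub>C\<^esub> f))" "far F (g \<cdot>\<^bsub>C\<^esub> f) \<cdot>\<^bsub>D\<^esub> h = far F u"
  then have *: "far F g \<cdot>\<^bsub>D\<^esub> (far F f \<cdot>\<^bsub>D\<^esub> h) = far F u" using gf by (simp add: D.Cmp_ac)
  obtain v where v: "v \<in> Arr C" "Dom C v = Dom C u" "Cod C v = Dom C g"
      "far F v = far F f \<cdot>\<^bsub>D\<^esub> h" "g \<cdot>\<^bsub>C\<^esub> v = u"
    by atomize_elim (rule cartesian_factor[OF g]; use u gf * in simp)
  obtain w where w: "w \<in> Arr C" "Dom C w = Dom C v" "Cod C w = Dom C f" "far F w = h"
      "f \<cdot>\<^bsub>C\<^esub> w = v"
    by atomize_elim (rule cartesian_factor[OF f]; use u gf v in simp)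
  have "(g \<cdot>\<^bsub>C\<^esub> f) \<cdot>\<^bsub>C\<^esub> w = u" using v w gf by (simp add: C.Cmp_ac)
  then show "\<exists>k. k \<in> Arr C \<and> Dom C k = Dom C u \<and> Cod C k = Dom C (g \<cdot>\<^bsub>C\<^esub> f) \<and> far F k = h
      \<and> (g \<cdot>\<^bsub>C\<^esub> f) \<cdot>\<^bsub>C\<^esub> k = u"
    using v w gf by (intro exI[of _ w]) simp
next
  note A [simp] = f[THEN cartesian_Arr] g[THEN cartesian_Arr]
  fix k k'
  assume k: "k \<in> Arr C" "k' \<in> Arr C" "Dom C k = Dom C k'" "Cod C k = Dom C (g \<cdot>\<^bsub>C\<^esub> f)"
    "Cod C k' = Dom C (g \<cdot>\<^bsub>C\<^esub> f)" "far F k = far F k'"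
    "(g \<cdot>\<^bsub>C\<^esub> f) \<cdot>\<^bsub>C\<^esub> k = (g \<cdot>\<^bsub>C\<^esub> f) \<cdot>\<^bsub>C\<^esub> k'"
  have "f \<cdot>\<^bsub>C\<^esub> k = f \<cdot>\<^bsub>C\<^esub> k'"
    by (rule cartesian_cancel[OF g]; use k gf in \<open>simp add: C.Cmp_ac\<close>)
  with k gf show "k = k'" by (intro cartesian_cancel[OF f, of k k']) simp_all
qed

text \<open>Each lift factors through the other over an identity, and both composites cancel against
  a Cartesian arrow. The equations and images of \<open>i\<close> and \<open>j\<close> are all
  exported because later arguments transport 2-cells along them.\<close>

lemma cartesian_unique_iso:
  assumes f: "cartesian C D F f" and g: "cartesian C D F g"
    and cod: "Cod C f = Cod C g" and im: "far F f = far F g"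
  obtains i j where "i \<in> Arr C" "Dom C i = Dom C f" "Cod C i = Dom C g"
    "j \<in> Arr C" "Dom C j = Dom C g" "Cod C j = Dom C f"
    "i \<cdot>\<^bsub>C\<^esub> j = Idn C (Dom C g)" "j \<cdot>\<^bsub>C\<^esub> i = Idn C (Dom C f)"
    "g \<cdot>\<^bsub>C\<^esub> i = f" "f \<cdot>\<^bsub>C\<^esub> j = g"
    "far F i = Idn D (fob F (Dom C f))" "far F j = Idn D (fob F (Dom C g))"
proof -
  note A [simp] = f[THEN cartesian_Arr] g[THEN cartesian_Arr]
  have dom: "fob F (Dom C f) = fob F (Dom C g)"
    using far_simps(2)[OF A(1)] far_simps(2)[OF A(2)] im by simp
  obtain i where i: "i \<in> Arr C" "Dom C i = Dom C f" "Cod C i = Dom C g"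
      "far F i = Idn D (fob F (Dom C f))" "g \<cdot>\<^bsub>C\<^esub> i = f"
    by atomize_elim (rule cartesian_factor[OF g]; use cod im dom in simp)
  obtain j where j: "j \<in> Arr C" "Dom C j = Dom C g" "Cod C j = Dom C f"
      "far F j = Idn D (fob F (Dom C g))" "f \<cdot>\<^bsub>C\<^esub> j = g"
    by atomize_elim (rule cartesian_factor[OF f]; use cod im dom in simp)
  have "i \<cdot>\<^bsub>C\<^esub> j = Idn C (Dom C g)"
    by (rule cartesian_cancel[OF g]; use i j dom in \<open>simp add: C.Cmp_ac[symmetric]\<close>)
  moreover have "j \<cdot>\<^bsub>C\<^esub> i = Idn C (Dom C f)"
    by (rule cartesian_cancel[OF f]; use i j dom in \<open>simp add: C.Cmp_ac[symmetric]\<close>)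
  ultimately show ?thesis using i j that by blast
qed

end

text \<open>Reduces preservation of Cartesian arrows by \<open>H\<close> to one conveniently chosen
  lift \<open>g\<close>: \<open>f\<close> is \<open>g\<close> precomposed with an isomorphism, whose
  image is again an isomorphism and therefore Cartesian.\<close>

lemma cartesian_image_transfer:
  assumes P: "cat_functor E B P" and P': "cat_functor E' B' P'" and H: "cat_functor E E' H"
    and f: "cartesian E B P f" and g: "cartesian E B P g"
    and "Cod E f = Cod E g" "far P f = far P g"
    and Hg: "cartesian E' B' P' (far H g)"
  shows "cartesian E' B' P' (far H f)"
proof -
  interpret P: cat_functor E B P by (fact P)
  interpret P': cat_functor E' B' P' by (fact P')
  interpret H: cat_functor E E' H by (fact H)
  note A [simp] = f[THEN P.cartesian_Arr] g[THEN P.cartesian_Arr]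
  obtain i j where i: "i \<in> Arr E" "Dom E i = Dom E f" "Cod E i = Dom E g"
    "j \<in> Arr E" "Dom E j = Dom E g" "Cod E j = Dom E f"
    "i \<cdot>\<^bsub>E\<^esub> j = Idn E (Dom E g)" "j \<cdot>\<^bsub>E\<^esub> i = Idn E (Dom E f)" "g \<cdot>\<^bsub>E\<^esub> i = f"
    using P.cartesian_unique_iso[OF f g] assms by metis
  have "cartesian E' B' P' (far H i)"
    by (rule P'.cartesian_iso[of _ "far H j"]) (use i in \<open>auto simp flip: H.far_Cmp_Arr\<close>)
  then have "cartesian E' B' P' (far H g \<cdot>\<^bsub>E'\<^esub> far H i)"
    using Hg i by (intro P'.cartesian_Cmp) auto
  then show ?thesis using i H.far_Cmp_Arr[of i g] by simp
qed

section \<open>Quintets form a double category\<close>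

lemma hom_cat_simps [simp]:
  "Obj (hom_cat K X Y) = hom (Und K) X Y"
  "Dom (hom_cat K X Y) = Dom (Ver K)" "Cod (hom_cat K X Y) = Cod (Ver K)"
  "Idn (hom_cat K X Y) = Idn (Ver K)" "Cmp (hom_cat K X Y) = Cmp (Ver K)"
  by (simp_all add: hom_cat_def)

section \<open>Whiskering and interchange of 2-cells\<close>

context two_category
begin

declare Obj_Ver [simp]

text \<open>Oriented so that the end objects of a 2-cell are always read off its domain arrow;
  composability conditions below are stated in this normal form.\<close>

lemma Ver_boundary [simp]:
  assumes "\<theta> \<in> Arr (Ver K)"
  shows "Dom (Ver K) \<theta> \<in> Arr (Und K)" "Cod (Ver K) \<theta> \<in> Arr (Und K)"
    "Dom (Und K) (Cod (Ver K) \<theta>) = Dom (Und K) (Dom (Ver K) \<theta>)"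
    "Cod (Und K) (Cod (Ver K) \<theta>) = Cod (Und K) (Dom (Ver K) \<theta>)"
  using V.Dom_in_Obj V.Cod_in_Obj assms parallel_Dom parallel_Cod by auto

lemma Arr_hom_cat [simp]:
  "\<theta> \<in> Arr (hom_cat K X Y) \<longleftrightarrow> \<theta> \<in> Arr (Ver K) \<and>
    Dom (Und K) (Dom (Ver K) \<theta>) = X \<and> Cod (Und K) (Dom (Ver K) \<theta>) = Y"
  by (auto simp: hom_cat_def hom_iff)

lemma HCmp_simps [simp]:
  assumes "\<theta> \<in> Arr (Ver K)" "\<phi> \<in> Arr (Ver K)"
    "Dom (Und K) (Dom (Ver K) \<phi>) = Cod (Und K) (Dom (Ver K) \<theta>)"
  shows "\<phi> \<star> \<theta> \<in> Arr (Ver K)"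
    "Dom (Ver K) (\<phi> \<star> \<theta>) = Dom (Ver K) \<phi> \<cdot>\<^bsub>Und K\<^esub> Dom (Ver K) \<theta>"
    "Cod (Ver K) (\<phi> \<star> \<theta>) = Cod (Ver K) \<phi> \<cdot>\<^bsub>Und K\<^esub> Cod (Ver K) \<theta>"
  using HCmp_in_hom[of \<theta> _ _ \<phi> _ "Dom (Ver K) \<theta>" "Cod (Ver K) \<theta>" "Dom (Ver K) \<phi>" "Cod (Ver K) \<phi>"]
    assms by (auto simp: hom_iff)

lemma HCmp_Idn_Arr [simp]:
  "f \<in> Arr (Und K) \<Longrightarrow> h \<in> Arr (Und K) \<Longrightarrow> Dom (Und K) h = Cod (Und K) f
    \<Longrightarrow> Idn (Ver K) h \<star> Idn (Ver K) f = Idn (Ver K) (h \<cdot>\<^bsub>Und K\<^esub> f)"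
  using HCmp_Idn by (auto simp: hom_iff)

lemma HCmp_unit [simp]:
  "\<theta> \<in> Arr (Ver K) \<Longrightarrow> Dom (Und K) (Dom (Ver K) \<theta>) = X \<Longrightarrow> \<theta> \<star> Idn (Ver K) (Idn (Und K) X) = \<theta>"
  "\<theta> \<in> Arr (Ver K) \<Longrightarrow> Cod (Und K) (Dom (Ver K) \<theta>) = X \<Longrightarrow> Idn (Ver K) (Idn (Und K) X) \<star> \<theta> = \<theta>"
  using HCmp_unit_left HCmp_unit_right by auto

lemma HCmp_ac:
  "\<theta> \<in> Arr (Ver K) \<Longrightarrow> \<phi> \<in> Arr (Ver K) \<Longrightarrow> \<psi> \<in> Arr (Ver K)
    \<Longrightarrow> Dom (Und K) (Dom (Ver K) \<phi>) = Cod (Und K) (Dom (Ver K) \<theta>)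
    \<Longrightarrow> Dom (Und K) (Dom (Ver K) \<psi>) = Cod (Und K) (Dom (Ver K) \<phi>)
    \<Longrightarrow> (\<psi> \<star> \<phi>) \<star> \<theta> = \<psi> \<star> (\<phi> \<star> \<theta>)"
  using HCmp_assoc by auto

lemma interchange_Arr:
  "\<theta> \<in> Arr (Ver K) \<Longrightarrow> \<theta>' \<in> Arr (Ver K) \<Longrightarrow> \<phi> \<in> Arr (Ver K) \<Longrightarrow> \<phi>' \<in> Arr (Ver K)
    \<Longrightarrow> Dom (Und K) (Dom (Ver K) \<phi>) = Cod (Und K) (Dom (Ver K) \<theta>)
    \<Longrightarrow> Dom (Ver K) \<theta>' = Cod (Ver K) \<theta> \<Longrightarrow> Dom (Ver K) \<phi>' = Cod (Ver K) \<phi>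
    \<Longrightarrow> (\<phi>' \<star> \<theta>') \<cdot>\<^bsub>Ver K\<^esub> (\<phi> \<star> \<theta>) = (\<phi>' \<cdot>\<^bsub>Ver K\<^esub> \<phi>) \<star> (\<theta>' \<cdot>\<^bsub>Ver K\<^esub> \<theta>)"
  using interchange by auto

lemma whisker_Cmp:
  assumes "\<theta> \<in> Arr (Ver K)" "\<theta>' \<in> Arr (Ver K)" "Dom (Ver K) \<theta>' = Cod (Ver K) \<theta>" "f \<in> Arr (Und K)"
  shows "Dom (Und K) f = Cod (Und K) (Dom (Ver K) \<theta>) \<Longrightarrow>
      Idn (Ver K) f \<star> (\<theta>' \<cdot>\<^bsub>Ver K\<^esub> \<theta>) =
      (Idn (Ver K) f \<star> \<theta>') \<cdot>\<^bsub>Ver K\<^esub> (Idn (Ver K) f \<star> \<theta>)"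
    and "Cod (Und K) f = Dom (Und K) (Dom (Ver K) \<theta>) \<Longrightarrow>
      (\<theta>' \<cdot>\<^bsub>Ver K\<^esub> \<theta>) \<star> Idn (Ver K) f =
      (\<theta>' \<star> Idn (Ver K) f) \<cdot>\<^bsub>Ver K\<^esub> (\<theta> \<star> Idn (Ver K) f)"
  using assms by (simp_all add: interchange_Arr)

text \<open>Together with \<open>whisker_Cmp\<close> this expands every pasting into a vertical
  composite of cells whiskered by one arrow at a time, which is the normal form in which pasting
  identities are compared.\<close>

lemma whisker_whisker:
  assumes "\<theta> \<in> Arr (Ver K)" "f \<in> Arr (Und K)" "g \<in> Arr (Und K)"
  shows "Dom (Und K) f = Cod (Und K) (Dom (Ver K) \<theta>) \<Longrightarrow> Dom (Und K) g = Cod (Und K) f \<Longrightarrow>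
      Idn (Ver K) (g \<cdot>\<^bsub>Und K\<^esub> f) \<star> \<theta> = Idn (Ver K) g \<star> (Idn (Ver K) f \<star> \<theta>)"
    and "Cod (Und K) g = Dom (Und K) (Dom (Ver K) \<theta>) \<Longrightarrow> Dom (Und K) g = Cod (Und K) f \<Longrightarrow>
      \<theta> \<star> Idn (Ver K) (g \<cdot>\<^bsub>Und K\<^esub> f) = (\<theta> \<star> Idn (Ver K) g) \<star> Idn (Ver K) f"
    and "Cod (Und K) f = Dom (Und K) (Dom (Ver K) \<theta>) \<Longrightarrow>
      Dom (Und K) g = Cod (Und K) (Dom (Ver K) \<theta>) \<Longrightarrow>
      (Idn (Ver K) g \<star> \<theta>) \<star> Idn (Ver K) f = Idn (Ver K) g \<star> (\<theta> \<star> Idn (Ver K) f)"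
  using assms by (simp_all add: HCmp_ac flip: HCmp_Idn_Arr)

text \<open>Interchange with identities inserted. The agreement of the two decompositions is what
  lets 2-cells in independent positions of a pasting slide past each other.\<close>

lemma HCmp_whisker:
  assumes "\<theta> \<in> Arr (Ver K)" "\<phi> \<in> Arr (Ver K)"
    "Dom (Und K) (Dom (Ver K) \<phi>) = Cod (Und K) (Dom (Ver K) \<theta>)"
  shows "(\<phi> \<star> Idn (Ver K) (Cod (Ver K) \<theta>)) \<cdot>\<^bsub>Ver K\<^esub> (Idn (Ver K) (Dom (Ver K) \<phi>) \<star> \<theta>) = \<phi> \<star> \<theta>"
    "(Idn (Ver K) (Cod (Ver K) \<phi>) \<star> \<theta>) \<cdot>\<^bsub>Ver K\<^esub> (\<phi> \<star> Idn (Ver K) (Dom (Ver K) \<theta>)) = \<phi> \<star> \<theta>"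
  using assms by (simp_all add: interchange_Arr)

lemma category_hom_cat: "category (hom_cat K X Y)"
  by unfold_locales (auto simp: hom_iff V.Cmp_ac)

end

section \<open>The double category of quintets\<close>

lemma quintet_cat_simps [simp]:
  "Obj (quintet_cat K) = Arr (Und K)" "Dom (quintet_cat K) = idom" "Cod (quintet_cat K) = icod"
  by (simp_all add: quintet_cat_def)

lemma Idn_quintet_cat:
  "Idn (quintet_cat K) m =
    Quintet m m (Idn (Und K) (Dom (Und K) m)) (Idn (Und K) (Cod (Und K) m)) (Idn (Ver K) m)"
  by (simp add: quintet_cat_def)

lemma Cmp_quintet_cat:
  "\<beta> \<cdot>\<^bsub>quintet_cat K\<^esub> \<alpha> = Quintet (idom \<alpha>) (icod \<beta>)
     (esrc \<beta> \<cdot>\<^bsub>Und K\<^esub> esrc \<alpha>) (etgt \<beta> \<cdot>\<^bsub>Und K\<^esub> etgt \<alpha>)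
     ((cell \<beta> \<star>\<^bsub>K\<^esub> Idn (Ver K) (esrc \<alpha>)) \<cdot>\<^bsub>Ver K\<^esub> (Idn (Ver K) (etgt \<beta>) \<star>\<^bsub>K\<^esub> cell \<alpha>))"
  by (simp add: quintet_cat_def)

lemma Arr_quintet_cat:
  "\<alpha> \<in> Arr (quintet_cat K) \<longleftrightarrow>
     idom \<alpha> \<in> Arr (Und K) \<and> icod \<alpha> \<in> Arr (Und K) \<and> esrc \<alpha> \<in> Arr (Und K) \<and> etgt \<alpha> \<in> Arr (Und K) \<and>
     Dom (Und K) (esrc \<alpha>) = Dom (Und K) (idom \<alpha>) \<and> Dom (Und K) (etgt \<alpha>) = Cod (Und K) (idom \<alpha>) \<and>
     Cod (Und K) (esrc \<alpha>) = Dom (Und K) (icod \<alpha>) \<and> Cod (Und K) (etgt \<alpha>) = Cod (Und K) (icod \<alpha>) \<and>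
     cell \<alpha> \<in> Arr (Ver K) \<and> Dom (Ver K) (cell \<alpha>) = etgt \<alpha> \<cdot>\<^bsub>Und K\<^esub> idom \<alpha> \<and>
     Cod (Ver K) (cell \<alpha>) = icod \<alpha> \<cdot>\<^bsub>Und K\<^esub> esrc \<alpha>"
  by (cases \<alpha>) (auto simp: quintet_cat_def quintet_cells_def hom_iff)

lemma quintets_simps [simp]:
  "D0 (quintets K) = Und K" "D1 (quintets K) = quintet_cat K"
  "fob (Src (quintets K)) = Dom (Und K)" "far (Src (quintets K)) = esrc"
  "fob (Tgt (quintets K)) = Cod (Und K)" "far (Tgt (quintets K)) = etgt"
  "fob (Unt (quintets K)) = Idn (Und K)"
  "fob (Ten (quintets K)) (m, m') = m' \<cdot>\<^bsub>Und K\<^esub> m"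
  by (simp_all add: quintets_def)

lemma far_Unt_quintets:
  "far (Unt (quintets K)) f =
     Quintet (Idn (Und K) (Dom (Und K) f)) (Idn (Und K) (Cod (Und K) f)) f f (Idn (Ver K) f)"
  by (simp add: quintets_def)

lemma far_Ten_quintets:
  "far (Ten (quintets K)) (\<alpha>, \<beta>) =
     Quintet (idom \<beta> \<cdot>\<^bsub>Und K\<^esub> idom \<alpha>) (icod \<beta> \<cdot>\<^bsub>Und K\<^esub> icod \<alpha>) (esrc \<alpha>) (etgt \<beta>)
       ((Idn (Ver K) (icod \<beta>) \<star>\<^bsub>K\<^esub> cell \<alpha>) \<cdot>\<^bsub>Ver K\<^esub> (cell \<beta> \<star>\<^bsub>K\<^esub> Idn (Ver K) (idom \<alpha>)))"
  by (simp add: quintets_def)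

lemma composables_simps [simp]:
  "(m, n) \<in> Obj (composables D) \<longleftrightarrow>
     m \<in> Obj (D1 D) \<and> n \<in> Obj (D1 D) \<and> fob (Tgt D) m = fob (Src D) n"
  "(\<alpha>, \<beta>) \<in> Arr (composables D) \<longleftrightarrow>
     \<alpha> \<in> Arr (D1 D) \<and> \<beta> \<in> Arr (D1 D) \<and> far (Tgt D) \<alpha> = far (Src D) \<beta>"
  "Dom (composables D) (\<alpha>, \<beta>) = (Dom (D1 D) \<alpha>, Dom (D1 D) \<beta>)"
  "Cod (composables D) (\<alpha>, \<beta>) = (Cod (D1 D) \<alpha>, Cod (D1 D) \<beta>)"
  "Idn (composables D) (m, n) = (Idn (D1 D) m, Idn (D1 D) n)"
  "(\<alpha>', \<beta>') \<cdot>\<^bsub>composables D\<^esub> (\<alpha>, \<beta>) = (\<alpha>' \<cdot>\<^bsub>D1 D\<^esub> \<alpha>, \<beta>' \<cdot>\<^bsub>D1 D\<^esub> \<beta>)"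
  by (simp_all add: composables_def)

lemma category_composables:
  assumes "cat_functor (D1 D) (D0 D) (Src D)" "cat_functor (D1 D) (D0 D) (Tgt D)"
  shows "category (composables D)"
proof -
  interpret S: cat_functor "D1 D" "D0 D" "Src D" by fact
  interpret T: cat_functor "D1 D" "D0 D" "Tgt D" by fact
  have S: "Dom (D0 D) (far (Src D) \<alpha>) = fob (Src D) (Dom (D1 D) \<alpha>)"
    "Cod (D0 D) (far (Src D) \<alpha>) = fob (Src D) (Cod (D1 D) \<alpha>)" if "\<alpha> \<in> Arr (D1 D)" for \<alpha>
    using that by auto
  \<comment> \<open>Taking domain and codomain of the shared arrow shows that the pairs of ends of a
    composable pair are themselves composable.\<close>
  have ends: "fob (Tgt D) (Dom (D1 D) \<alpha>) = fob (Src D) (Dom (D1 D) \<beta>)"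
      "fob (Tgt D) (Cod (D1 D) \<alpha>) = fob (Src D) (Cod (D1 D) \<beta>)"
    if "\<alpha> \<in> Arr (D1 D)" "\<beta> \<in> Arr (D1 D)" "far (Tgt D) \<alpha> = far (Src D) \<beta>" for \<alpha> \<beta>
    using that T.far_simps[of \<alpha>] S.far_simps[of \<beta>] by auto
  show ?thesis
    by unfold_locales (auto simp: hom_iff S.C.Cmp_ac ends)
qed

context two_category
begin

lemma Arr_Cmp_quintet:
  assumes "\<alpha> \<in> Arr (quintet_cat K)" "\<beta> \<in> Arr (quintet_cat K)" "idom \<beta> = icod \<alpha>"
  shows "\<beta> \<cdot>\<^bsub>quintet_cat K\<^esub> \<alpha> \<in> Arr (quintet_cat K)"
  using assms unfolding Arr_quintet_cat by (simp add: Cmp_quintet_cat U.Cmp_ac)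

lemma category_quintet_cat: "category (quintet_cat K)"
proof (unfold_locales, goal_cases)
  case (4 \<alpha> X Y \<beta> Z)
  then show ?case using Arr_Cmp_quintet by (auto simp: hom_iff Cmp_quintet_cat)
next
  case (7 \<alpha> W X \<beta> Y \<gamma> Z)
  then have "\<alpha> \<in> Arr (quintet_cat K)" "\<beta> \<in> Arr (quintet_cat K)" "\<gamma> \<in> Arr (quintet_cat K)"
    "idom \<beta> = icod \<alpha>" "idom \<gamma> = icod \<beta>"
    by (auto simp: hom_iff)
  then show ?case
    unfolding Arr_quintet_cat
    by (simp add: Cmp_quintet_cat U.Cmp_ac V.Cmp_ac whisker_Cmp whisker_whisker)
qed (auto simp: hom_iff Arr_quintet_cat Idn_quintet_cat Cmp_quintet_cat quintet.expand)

lemma functor_Src_quintets: "cat_functor (quintet_cat K) (Und K) (Src (quintets K))"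
  by (intro cat_functor.intro category_quintet_cat U.category_axioms, unfold_locales)
    (auto simp: hom_iff Arr_quintet_cat Idn_quintet_cat Cmp_quintet_cat)

lemma functor_Tgt_quintets: "cat_functor (quintet_cat K) (Und K) (Tgt (quintets K))"
  by (intro cat_functor.intro category_quintet_cat U.category_axioms, unfold_locales)
    (auto simp: hom_iff Arr_quintet_cat Idn_quintet_cat Cmp_quintet_cat)

lemma functor_Unt_quintets: "cat_functor (Und K) (quintet_cat K) (Unt (quintets K))"
  by (intro cat_functor.intro category_quintet_cat U.category_axioms, unfold_locales)
    (auto simp: hom_iff Arr_quintet_cat Idn_quintet_cat Cmp_quintet_cat far_Unt_quintets)

lemma category_composables_quintets: "category (composables (quintets K))"
  by (rule category_composables) (simp_all add: functor_Src_quintets functor_Tgt_quintets)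

lemma Arr_Ten_quintets:
  assumes "\<alpha> \<in> Arr (quintet_cat K)" "\<beta> \<in> Arr (quintet_cat K)" "etgt \<alpha> = esrc \<beta>"
  shows "far (Ten (quintets K)) (\<alpha>, \<beta>) \<in> Arr (quintet_cat K)"
  using assms unfolding Arr_quintet_cat by (simp add: far_Ten_quintets U.Cmp_ac)

text \<open>Interchange for a two-by-two grid of quintets. Both pastings consist of the same four
  whiskered cells; they differ only in the order of the opposite corners \<alpha> and \<beta>',
  which share no side.\<close>

lemma Ten_Cmp_quintets:
  assumes A: "\<alpha> \<in> Arr (quintet_cat K)" "\<beta> \<in> Arr (quintet_cat K)"
    "\<alpha>' \<in> Arr (quintet_cat K)" "\<beta>' \<in> Arr (quintet_cat K)"
    and bd: "esrc \<beta> = etgt \<alpha>" "esrc \<beta>' = etgt \<alpha>'" "idom \<alpha>' = icod \<alpha>" "idom \<beta>' = icod \<beta>"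
  shows "far (Ten (quintets K)) (\<alpha>' \<cdot>\<^bsub>quintet_cat K\<^esub> \<alpha>, \<beta>' \<cdot>\<^bsub>quintet_cat K\<^esub> \<beta>) =
    far (Ten (quintets K)) (\<alpha>', \<beta>') \<cdot>\<^bsub>quintet_cat K\<^esub> far (Ten (quintets K)) (\<alpha>, \<beta>)"
proof -
  let ?c = "cell \<alpha>" and ?c' = "cell \<beta>'"
  \<comment> \<open>The opposite corners are horizontally composable, so both sides are the
    horizontal composite of their cells.\<close>
  have mid: "(Idn (Ver K) (icod \<beta>') \<star> (Idn (Ver K) (etgt \<alpha>') \<star> ?c)) \<cdot>\<^bsub>Ver K\<^esub>
      ((?c' \<star> Idn (Ver K) (etgt \<alpha>)) \<star> Idn (Ver K) (idom \<alpha>)) =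
      ((?c' \<star> Idn (Ver K) (icod \<alpha>)) \<star> Idn (Ver K) (esrc \<alpha>)) \<cdot>\<^bsub>Ver K\<^esub>
      (Idn (Ver K) (etgt \<beta>') \<star> (Idn (Ver K) (icod \<beta>) \<star> ?c))"
    using HCmp_whisker[of ?c ?c'] A bd unfolding Arr_quintet_cat
    by (simp add: whisker_whisker)
  \<comment> \<open>With vertical composites bracketed to the right, the two corner cells are
    followed by a remaining factor \<psi>, so the exchange is needed with \<psi> attached.\<close>
  have mid': "(Idn (Ver K) (icod \<beta>') \<star> (Idn (Ver K) (etgt \<alpha>') \<star> ?c)) \<cdot>\<^bsub>Ver K\<^esub>
      (((?c' \<star> Idn (Ver K) (etgt \<alpha>)) \<star> Idn (Ver K) (idom \<alpha>)) \<cdot>\<^bsub>Ver K\<^esub> \<psi>) =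
      ((?c' \<star> Idn (Ver K) (icod \<alpha>)) \<star> Idn (Ver K) (esrc \<alpha>)) \<cdot>\<^bsub>Ver K\<^esub>
      ((Idn (Ver K) (etgt \<beta>') \<star> (Idn (Ver K) (icod \<beta>) \<star> ?c)) \<cdot>\<^bsub>Ver K\<^esub> \<psi>)"
    if "\<psi> \<in> Arr (Ver K)"
      "Cod (Ver K) \<psi> = etgt \<beta>' \<cdot>\<^bsub>Und K\<^esub> (icod \<beta> \<cdot>\<^bsub>Und K\<^esub> (etgt \<alpha> \<cdot>\<^bsub>Und K\<^esub> idom \<alpha>))" for \<psi>
    using arg_cong[OF mid, of "\<lambda>\<xi>. \<xi> \<cdot>\<^bsub>Ver K\<^esub> \<psi>"] that A bd unfolding Arr_quintet_cat
    by (simp add: U.Cmp_ac V.Cmp_ac)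
  show ?thesis
    using A bd unfolding Arr_quintet_cat
    by (simp add: far_Ten_quintets Cmp_quintet_cat U.Cmp_ac V.Cmp_ac whisker_Cmp whisker_whisker mid')
qed

lemma functor_Ten_quintets:
  "cat_functor (composables (quintets K)) (quintet_cat K) (Ten (quintets K))"
proof (intro cat_functor.intro category_composables_quintets category_quintet_cat, unfold_locales, goal_cases)
  case (1 X)
  then show ?case by (cases X) auto
next
  case (2 f X Y)
  then show ?case using Arr_Ten_quintets
    by (cases f) (auto simp: hom_iff far_Ten_quintets)
next
  case (3 X)
  then show ?case by (cases X) (auto simp: far_Ten_quintets Idn_quintet_cat)
next
  case (4 f X Y g Z)
  then show ?case by (cases f; cases g) (auto simp: hom_iff intro!: Ten_Cmp_quintets)
qed

lemma double_category_quintets: "double_category (quintets K)"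
proof (intro double_category.intro, goal_cases)
  case 7
  show ?case
  proof (unfold_locales, goal_cases)
    case (13 m n p)
    then show ?case by (simp add: U.Cmp_ac)
  next
    case (14 \<alpha> \<beta> \<gamma>)
    then have "\<alpha> \<in> Arr (quintet_cat K)" "\<beta> \<in> Arr (quintet_cat K)" "\<gamma> \<in> Arr (quintet_cat K)"
      "esrc \<beta> = etgt \<alpha>" "esrc \<gamma> = etgt \<beta>"
      by auto
    then show ?case unfolding Arr_quintet_cat
      by (simp add: far_Ten_quintets U.Cmp_ac V.Cmp_ac whisker_Cmp whisker_whisker)
  qed (auto simp: Arr_quintet_cat far_Unt_quintets far_Ten_quintets quintet.expand)
qed (simp_all add: U.category_axioms category_quintet_cat functor_Src_quintets functor_Tgt_quintets
    functor_Unt_quintets functor_Ten_quintets)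

end

section \<open>2-functors and quintets\<close>

lemma func_simps [simp]:
  "fob (und_func P) = on0 P" "far (und_func P) = on1 P"
  "fob (loc_func P) = on1 P" "far (loc_func P) = on2 P"
  "F0 (quintets_func P) = und_func P" "fob (F1 (quintets_func P)) = on1 P"
  "far (F1 (quintets_func P)) = map_quintet (on1 P) (on2 P)"
  "fob (composables_func R) = map_prod (fob (F1 R)) (fob (F1 R))"
  "far (composables_func R) = map_prod (far (F1 R)) (far (F1 R))"
  by (simp_all add: und_func_def loc_func_def quintets_func_def composables_func_def)

declare quintet.map_sel [simp]

text \<open>Globular cells: a 2-cell is placed between its domain and codomain as internal ends,
  with identities on the external sides. These identities are computed from the 2-cell, so one
  functor record serves every hom-category.\<close>

definition quintet_incl :: "('o, 'a, 'c) two_cat \<Rightarrow> ('a, 'c, 'a, ('a, 'c) quintet) func" where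
  "quintet_incl K = \<lparr>fob = id, far = (\<lambda>\<theta>. Quintet (Dom (Ver K) \<theta>) (Cod (Ver K) \<theta>)
     (Idn (Und K) (Dom (Und K) (Dom (Ver K) \<theta>))) (Idn (Und K) (Cod (Und K) (Dom (Ver K) \<theta>))) \<theta>)\<rparr>"

lemma quintet_incl_simps [simp]:
  "fob (quintet_incl K) m = m"
  "far (quintet_incl K) \<theta> = Quintet (Dom (Ver K) \<theta>) (Cod (Ver K) \<theta>)
     (Idn (Und K) (Dom (Und K) (Dom (Ver K) \<theta>))) (Idn (Und K) (Cod (Und K) (Dom (Ver K) \<theta>))) \<theta>"
  by (simp_all add: quintet_incl_def)

text \<open>Vertical composition becomes internal composition because all whiskerings are by
  identities. Functoriality allows Cartesianness to be transported from one lift of a 2-cell to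
  another.\<close>

lemma (in two_category) functor_quintet_incl:
  "cat_functor (hom_cat K X Y) (quintet_cat K) (quintet_incl K)"
  by (intro cat_functor.intro category_hom_cat category_quintet_cat, unfold_locales)
    (auto simp: hom_iff Arr_quintet_cat Idn_quintet_cat Cmp_quintet_cat)

lemma functor_composables:
  assumes "strict_double_functor D D' R"
  shows "cat_functor (composables D) (composables D') (composables_func R)"
proof -
  interpret strict_double_functor D D' R by fact
  show ?thesis
    by unfold_locales (auto simp: hom_iff simp flip: P_Src P_Tgt)
qed

context two_functor
begin

lemma on_simps [simp]:
  "X \<in> Obj (Und E) \<Longrightarrow> on0 P X \<in> Obj (Und B)"
  "X \<in> Obj (Und E) \<Longrightarrow> on1 P (Idn (Und E) X) = Idn (Und B) (on0 P X)"
  "f \<in> Arr (Und E) \<Longrightarrow> on1 P f \<in> Arr (Und B)"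
  "f \<in> Arr (Und E) \<Longrightarrow> Dom (Und B) (on1 P f) = on0 P (Dom (Und E) f)"
  "f \<in> Arr (Und E) \<Longrightarrow> Cod (Und B) (on1 P f) = on0 P (Cod (Und E) f)"
  "f \<in> Arr (Und E) \<Longrightarrow> g \<in> Arr (Und E) \<Longrightarrow> Dom (Und E) g = Cod (Und E) f
    \<Longrightarrow> on1 P (g \<cdot>\<^bsub>Und E\<^esub> f) = on1 P g \<cdot>\<^bsub>Und B\<^esub> on1 P f"
  "f \<in> Arr (Und E) \<Longrightarrow> on2 P (Idn (Ver E) f) = Idn (Ver B) (on1 P f)"
  "\<theta> \<in> Arr (Ver E) \<Longrightarrow> on2 P \<theta> \<in> Arr (Ver B)"
  "\<theta> \<in> Arr (Ver E) \<Longrightarrow> Dom (Ver B) (on2 P \<theta>) = on1 P (Dom (Ver E) \<theta>)"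
  "\<theta> \<in> Arr (Ver E) \<Longrightarrow> Cod (Ver B) (on2 P \<theta>) = on1 P (Cod (Ver E) \<theta>)"
  "\<theta> \<in> Arr (Ver E) \<Longrightarrow> \<phi> \<in> Arr (Ver E) \<Longrightarrow> Dom (Ver E) \<phi> = Cod (Ver E) \<theta>
    \<Longrightarrow> on2 P (\<phi> \<cdot>\<^bsub>Ver E\<^esub> \<theta>) = on2 P \<phi> \<cdot>\<^bsub>Ver B\<^esub> on2 P \<theta>"
  using U.fob_in_Obj[of X] U.far_Idn[of X] U.far_simps[of f] U.far_Cmp_Arr[of f g]
    V.far_Idn[of f] V.far_simps[of \<theta>] V.far_Cmp_Arr[of \<theta> \<phi>]
  by simp_all

lemma on2_HCmp_Arr [simp]:
  "\<theta> \<in> Arr (Ver E) \<Longrightarrow> \<phi> \<in> Arr (Ver E)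
    \<Longrightarrow> Dom (Und E) (Dom (Ver E) \<phi>) = Cod (Und E) (Dom (Ver E) \<theta>)
    \<Longrightarrow> on2 P (\<phi> \<star>\<^bsub>E\<^esub> \<theta>) = on2 P \<phi> \<star>\<^bsub>B\<^esub> on2 P \<theta>"
  using on2_HCmp by auto

lemma functor_hom_cat:
  "cat_functor (hom_cat E X Y) (hom_cat B (on0 P X) (on0 P Y)) (loc_func P)"
  by (intro cat_functor.intro E.category_hom_cat B.category_hom_cat, unfold_locales)
    (auto simp: hom_iff)

lemma functor_quintets: "cat_functor (quintet_cat E) (quintet_cat B) (F1 (quintets_func P))"
  by (intro cat_functor.intro E.category_quintet_cat B.category_quintet_cat, unfold_locales)
    (auto simp: hom_iff Arr_quintet_cat Idn_quintet_cat Cmp_quintet_cat E.U.Cmp_ac)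

lemma strict_double_functor_quintets:
  "strict_double_functor (quintets E) (quintets B) (quintets_func P)"
proof (intro strict_double_functor.intro E.double_category_quintets B.double_category_quintets,
    goal_cases)
  case 3
  show ?case
    by unfold_locales (auto simp: Arr_quintet_cat far_Unt_quintets far_Ten_quintets E.U.Cmp_ac)
qed (simp_all add: functor_quintets U.cat_functor_axioms)

section \<open>Factorization and cancellation along 2-Cartesian arrows\<close>

lemma two_cartesian_cartesian:
  "two_cartesian E B P f \<Longrightarrow> cartesian (Und E) (Und B) (und_func P) f"
  by (simp add: two_cartesian_def)

text \<open>Takes the lifted arrows \<open>h\<close> and \<open>l\<close> as data, so that the
  boundary of \<theta> is a pair of composites with \<open>f\<close>; this is the shape in which
  every use arises.\<close>

lemma two_cartesian_ex1:
  assumes "two_cartesian E B P f"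
    and "h \<in> Arr (Und E)" "l \<in> Arr (Und E)" "Dom (Und E) l = Dom (Und E) h"
      "Cod (Und E) h = Dom (Und E) f" "Cod (Und E) l = Dom (Und E) f"
    and "\<theta> \<in> Arr (Ver E)" "Dom (Ver E) \<theta> = f \<cdot>\<^bsub>Und E\<^esub> h" "Cod (Ver E) \<theta> = f \<cdot>\<^bsub>Und E\<^esub> l"
    and "\<gamma> \<in> Arr (Ver B)" "Dom (Ver B) \<gamma> = on1 P h" "Cod (Ver B) \<gamma> = on1 P l"
    and "on2 P \<theta> = Idn (Ver B) (on1 P f) \<star>\<^bsub>B\<^esub> \<gamma>"
  shows "\<exists>!\<gamma>'. \<gamma>' \<in> hom (Ver E) h l \<and> on2 P \<gamma>' = \<gamma> \<and> Idn (Ver E) f \<star>\<^bsub>E\<^esub> \<gamma>' = \<theta>"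
proof -
  have f: "f \<in> Arr (Und E)" using assms(1) by (simp add: two_cartesian_def cartesian_def)
  have "Dom (Und E) h \<in> Obj (Und E)" "f \<in> hom (Und E) (Dom (Und E) f) (Cod (Und E) f)"
    "f \<cdot>\<^bsub>Und E\<^esub> h \<in> hom (Und E) (Dom (Und E) h) (Cod (Und E) f)"
    "f \<cdot>\<^bsub>Und E\<^esub> l \<in> hom (Und E) (Dom (Und E) h) (Cod (Und E) f)"
    "\<theta> \<in> hom (Ver E) (f \<cdot>\<^bsub>Und E\<^esub> h) (f \<cdot>\<^bsub>Und E\<^esub> l)"
    "on1 P h \<in> hom (Und B) (on0 P (Dom (Und E) h)) (on0 P (Dom (Und E) f))"
    "on1 P l \<in> hom (Und B) (on0 P (Dom (Und E) h)) (on0 P (Dom (Und E) f))"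
    "\<gamma> \<in> hom (Ver B) (on1 P h) (on1 P l)"
    "h \<in> hom (Und E) (Dom (Und E) h) (Dom (Und E) f)"
    "l \<in> hom (Und E) (Dom (Und E) h) (Dom (Und E) f)"
    using f assms by (simp_all add: hom_iff)
  then show ?thesis
    using assms(1,13) unfolding two_cartesian_def by blast
qed

lemma two_cartesian_factor:
  assumes "two_cartesian E B P f"
    and "h \<in> Arr (Und E)" "l \<in> Arr (Und E)" "Dom (Und E) l = Dom (Und E) h"
      "Cod (Und E) h = Dom (Und E) f" "Cod (Und E) l = Dom (Und E) f"
    and "\<theta> \<in> Arr (Ver E)" "Dom (Ver E) \<theta> = f \<cdot>\<^bsub>Und E\<^esub> h" "Cod (Ver E) \<theta> = f \<cdot>\<^bsub>Und E\<^esub> l"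
    and "\<gamma> \<in> Arr (Ver B)" "Dom (Ver B) \<gamma> = on1 P h" "Cod (Ver B) \<gamma> = on1 P l"
    and "on2 P \<theta> = Idn (Ver B) (on1 P f) \<star>\<^bsub>B\<^esub> \<gamma>"
  shows "\<exists>\<gamma>'. \<gamma>' \<in> Arr (Ver E) \<and> Dom (Ver E) \<gamma>' = h \<and> Cod (Ver E) \<gamma>' = l \<and> on2 P \<gamma>' = \<gamma> \<and>
    Idn (Ver E) f \<star>\<^bsub>E\<^esub> \<gamma>' = \<theta>"
  using two_cartesian_ex1[OF assms] by (auto simp: hom_iff)

lemma two_cartesian_cancel:
  assumes f: "two_cartesian E B P f" and "\<gamma> \<in> Arr (Ver E)" "\<gamma>' \<in> Arr (Ver E)"
    "Dom (Ver E) \<gamma>' = Dom (Ver E) \<gamma>" "Cod (Ver E) \<gamma>' = Cod (Ver E) \<gamma>"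
    "Cod (Und E) (Dom (Ver E) \<gamma>) = Dom (Und E) f"
    "on2 P \<gamma>' = on2 P \<gamma>" "Idn (Ver E) f \<star>\<^bsub>E\<^esub> \<gamma>' = Idn (Ver E) f \<star>\<^bsub>E\<^esub> \<gamma>"
  shows "\<gamma>' = \<gamma>"
proof -
  have A: "f \<in> Arr (Und E)" using assms(1) by (simp add: two_cartesian_def cartesian_def)
  have "\<exists>!\<delta>. \<delta> \<in> hom (Ver E) (Dom (Ver E) \<gamma>) (Cod (Ver E) \<gamma>) \<and> on2 P \<delta> = on2 P \<gamma> \<and>
      Idn (Ver E) f \<star>\<^bsub>E\<^esub> \<delta> = Idn (Ver E) f \<star>\<^bsub>E\<^esub> \<gamma>"
    by (rule two_cartesian_ex1[OF f]) (use A assms in simp_all)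
  moreover have "\<gamma> \<in> hom (Ver E) (Dom (Ver E) \<gamma>) (Cod (Ver E) \<gamma>)"
    "\<gamma>' \<in> hom (Ver E) (Dom (Ver E) \<gamma>) (Cod (Ver E) \<gamma>)"
    using assms by (simp_all add: hom_iff)
  ultimately show ?thesis using assms(7,8) by metis
qed

lemma two_cartesianI:
  assumes f: "cartesian (Und E) (Und B) (und_func P) f"
    and factor: "\<And>h l \<theta> \<gamma>. \<lbrakk>h \<in> Arr (Und E); l \<in> Arr (Und E); Dom (Und E) l = Dom (Und E) h;
        Cod (Und E) h = Dom (Und E) f; Cod (Und E) l = Dom (Und E) f;
        \<theta> \<in> Arr (Ver E); Dom (Ver E) \<theta> = f \<cdot>\<^bsub>Und E\<^esub> h; Cod (Ver E) \<theta> = f \<cdot>\<^bsub>Und E\<^esub> l;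
        \<gamma> \<in> Arr (Ver B); Dom (Ver B) \<gamma> = on1 P h; Cod (Ver B) \<gamma> = on1 P l;
        on2 P \<theta> = Idn (Ver B) (on1 P f) \<star>\<^bsub>B\<^esub> \<gamma>\<rbrakk>
      \<Longrightarrow> \<exists>\<gamma>'. \<gamma>' \<in> Arr (Ver E) \<and> Dom (Ver E) \<gamma>' = h \<and> Cod (Ver E) \<gamma>' = l \<and> on2 P \<gamma>' = \<gamma> \<and>
        Idn (Ver E) f \<star>\<^bsub>E\<^esub> \<gamma>' = \<theta>"
    and cancel: "\<And>\<gamma> \<gamma>'. \<lbrakk>\<gamma> \<in> Arr (Ver E); \<gamma>' \<in> Arr (Ver E);
        Dom (Ver E) \<gamma>' = Dom (Ver E) \<gamma>; Cod (Ver E) \<gamma>' = Cod (Ver E) \<gamma>;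
        Cod (Und E) (Dom (Ver E) \<gamma>) = Dom (Und E) f;
        on2 P \<gamma>' = on2 P \<gamma>; Idn (Ver E) f \<star>\<^bsub>E\<^esub> \<gamma>' = Idn (Ver E) f \<star>\<^bsub>E\<^esub> \<gamma>\<rbrakk> \<Longrightarrow> \<gamma>' = \<gamma>"
  shows "two_cartesian E B P f"
  unfolding two_cartesian_def
proof (intro conjI f ballI allI impI, elim conjE)
  fix Z X Y g k \<theta> h l \<gamma> h' l'
  assume "f \<in> hom (Und E) X Y" "g \<in> hom (Und E) Z Y" "k \<in> hom (Und E) Z Y" "\<theta> \<in> hom (Ver E) g k"
    "\<gamma> \<in> hom (Ver B) h l" "on2 P \<theta> = Idn (Ver B) (on1 P f) \<star>\<^bsub>B\<^esub> \<gamma>"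
    and h': "h' \<in> hom (Und E) Z X" "l' \<in> hom (Und E) Z X"
    and "on1 P h' = h" "f \<cdot>\<^bsub>Und E\<^esub> h' = g" "on1 P l' = l" "f \<cdot>\<^bsub>Und E\<^esub> l' = k"
  then have "\<exists>\<gamma>'. \<gamma>' \<in> Arr (Ver E) \<and> Dom (Ver E) \<gamma>' = h' \<and> Cod (Ver E) \<gamma>' = l' \<and>
      on2 P \<gamma>' = \<gamma> \<and> Idn (Ver E) f \<star>\<^bsub>E\<^esub> \<gamma>' = \<theta>"
    by (intro factor) (simp_all add: hom_iff)
  then show "\<exists>!\<gamma>'. \<gamma>' \<in> hom (Ver E) h' l' \<and> on2 P \<gamma>' = \<gamma> \<and> Idn (Ver E) f \<star>\<^bsub>E\<^esub> \<gamma>' = \<theta>"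
  proof (elim exE conjE, intro ex1I)
    fix \<gamma>' \<delta>
    assume "\<gamma>' \<in> Arr (Ver E)" "Dom (Ver E) \<gamma>' = h'" "Cod (Ver E) \<gamma>' = l'" "on2 P \<gamma>' = \<gamma>"
      "Idn (Ver E) f \<star>\<^bsub>E\<^esub> \<gamma>' = \<theta>"
      and "\<delta> \<in> hom (Ver E) h' l' \<and> on2 P \<delta> = \<gamma> \<and> Idn (Ver E) f \<star>\<^bsub>E\<^esub> \<delta> = \<theta>"
    then show "\<delta> = \<gamma>'"
      using \<open>f \<in> hom (Und E) X Y\<close> h' cancel[of \<gamma>' \<delta>] by (simp add: hom_iff)
  qed (simp add: hom_iff)
qed

section \<open>Cartesian 2-cells and a criterion for Cartesian quintets\<close>

lemma cartesian_two_cell_Arr: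
  assumes "cartesian_two_cell E B P X Y \<theta>"
  shows "\<theta> \<in> Arr (Ver E)" "Dom (Und E) (Dom (Ver E) \<theta>) = X" "Cod (Und E) (Dom (Ver E) \<theta>) = Y"
  using assms by (simp_all add: cartesian_two_cell_def cartesian_def)

lemma cartesian_two_cell_factor:
  assumes \<theta>: "cartesian_two_cell E B P X Y \<theta>"
    and \<tau>: "\<tau> \<in> Arr (Ver E)" "Cod (Ver E) \<tau> = Cod (Ver E) \<theta>"
    and \<gamma>: "\<gamma> \<in> Arr (Ver B)" "Dom (Ver B) \<gamma> = on1 P (Dom (Ver E) \<tau>)"
      "Cod (Ver B) \<gamma> = on1 P (Dom (Ver E) \<theta>)" "on2 P \<theta> \<cdot>\<^bsub>Ver B\<^esub> \<gamma> = on2 P \<tau>"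
  shows "\<exists>\<kappa>. \<kappa> \<in> Arr (Ver E) \<and> Dom (Ver E) \<kappa> = Dom (Ver E) \<tau> \<and> Cod (Ver E) \<kappa> = Dom (Ver E) \<theta> \<and>
    on2 P \<kappa> = \<gamma> \<and> \<theta> \<cdot>\<^bsub>Ver E\<^esub> \<kappa> = \<tau>"
proof -
  interpret L: cat_functor "hom_cat E X Y" "hom_cat B (on0 P X) (on0 P Y)" "loc_func P"
    by (rule functor_hom_cat)
  note T = cartesian_two_cell_Arr[OF \<theta>]
  have "Dom (Und E) (Dom (Ver E) \<tau>) = X" "Cod (Und E) (Dom (Ver E) \<tau>) = Y"
    using T \<tau> E.Ver_boundary[of \<tau>] E.Ver_boundary[of \<theta>] by auto
  with T \<tau> \<gamma> have "\<exists>\<kappa>. \<kappa> \<in> Arr (hom_cat E X Y) \<and> Dom (hom_cat E X Y) \<kappa> = Dom (hom_cat E X Y) \<tau> \<and>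
      Cod (hom_cat E X Y) \<kappa> = Dom (hom_cat E X Y) \<theta> \<and> far (loc_func P) \<kappa> = \<gamma> \<and>
      \<theta> \<cdot>\<^bsub>hom_cat E X Y\<^esub> \<kappa> = \<tau>"
    by (intro L.cartesian_factor \<theta>[unfolded cartesian_two_cell_def]) simp_all
  then show ?thesis by auto
qed

lemma cartesian_two_cell_cancel:
  assumes \<theta>: "cartesian_two_cell E B P X Y \<theta>"
    and \<kappa>: "\<kappa> \<in> Arr (Ver E)" "\<kappa>' \<in> Arr (Ver E)" "Dom (Ver E) \<kappa> = Dom (Ver E) \<kappa>'"
      "Cod (Ver E) \<kappa> = Dom (Ver E) \<theta>" "Cod (Ver E) \<kappa>' = Dom (Ver E) \<theta>" "on2 P \<kappa> = on2 P \<kappa>'"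
      "\<theta> \<cdot>\<^bsub>Ver E\<^esub> \<kappa> = \<theta> \<cdot>\<^bsub>Ver E\<^esub> \<kappa>'"
  shows "\<kappa> = \<kappa>'"
proof -
  interpret L: cat_functor "hom_cat E X Y" "hom_cat B (on0 P X) (on0 P Y)" "loc_func P"
    by (rule functor_hom_cat)
  have "Dom (Und E) (Dom (Ver E) \<kappa>') = X" "Cod (Und E) (Dom (Ver E) \<kappa>') = Y"
    using cartesian_two_cell_Arr[OF \<theta>] \<kappa> E.Ver_boundary[of \<kappa>'] by auto
  then show ?thesis
    using \<kappa> L.cartesian_cancel[OF \<theta>[unfolded cartesian_two_cell_def], of \<kappa> \<kappa>'] by simp
qed

text \<open>The 2-cell of a factorization is found in two steps: first through the Cartesian 2-cell
  \<open>cell \<alpha> \<star> s\<close>, then through the 2-Cartesian arrow \<open>etgt \<alpha>\<close>.\<close>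

lemma cartesian_quintetI:
  assumes \<alpha>: "\<alpha> \<in> Arr (quintet_cat E)"
    and src: "cartesian (Und E) (Und B) (und_func P) (esrc \<alpha>)"
    and tgt: "two_cartesian E B P (etgt \<alpha>)"
    and stable: "\<And>s. s \<in> Arr (Und E) \<Longrightarrow> Cod (Und E) s = Dom (Und E) (esrc \<alpha>) \<Longrightarrow>
      cartesian_two_cell E B P (Dom (Und E) s) (Cod (Und E) (icod \<alpha>))
        (cell \<alpha> \<star>\<^bsub>E\<^esub> Idn (Ver E) s)"
  shows "cartesian (quintet_cat E) (quintet_cat B) (F1 (quintets_func P)) \<alpha>"
proof -
  interpret Q: cat_functor "quintet_cat E" "quintet_cat B" "F1 (quintets_func P)"
    by (rule functor_quintets)
  show ?thesis
  proof (rule Q.cartesianI[OF \<alpha>])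
    fix \<tau> \<eta>
    assume "\<tau> \<in> Arr (quintet_cat E)" "Cod (quintet_cat E) \<tau> = Cod (quintet_cat E) \<alpha>"
      "\<eta> \<in> Arr (quintet_cat B)"
      "Dom (quintet_cat B) \<eta> = fob (F1 (quintets_func P)) (Dom (quintet_cat E) \<tau>)"
      "Cod (quintet_cat B) \<eta> = fob (F1 (quintets_func P)) (Dom (quintet_cat E) \<alpha>)"
      and eq: "far (F1 (quintets_func P)) \<alpha> \<cdot>\<^bsub>quintet_cat B\<^esub> \<eta> = far (F1 (quintets_func P)) \<tau>"
    note bd = this(1-5)[simplified] \<alpha>
    have eqs: "on1 P (esrc \<alpha>) \<cdot>\<^bsub>Und B\<^esub> esrc \<eta> = on1 P (esrc \<tau>)"
      "on1 P (etgt \<alpha>) \<cdot>\<^bsub>Und B\<^esub> etgt \<eta> = on1 P (etgt \<tau>)"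
      "(on2 P (cell \<alpha>) \<star>\<^bsub>B\<^esub> Idn (Ver B) (esrc \<eta>)) \<cdot>\<^bsub>Ver B\<^esub>
        (Idn (Ver B) (on1 P (etgt \<alpha>)) \<star>\<^bsub>B\<^esub> cell \<eta>) = on2 P (cell \<tau>)"
      using arg_cong[OF eq, of esrc] arg_cong[OF eq, of etgt] arg_cong[OF eq, of cell]
      by (simp_all add: Cmp_quintet_cat)
    note bd' = bd[unfolded Arr_quintet_cat]
    \<comment> \<open>The arrow \<open>s\<close> appears only after factoring the external source,
      and it whiskers the cell of \<alpha> in the composite. This is why \<open>stable\<close>
      ranges over all arrows into the domain of \<open>esrc \<alpha>\<close>.\<close>
    obtain s where s: "s \<in> Arr (Und E)" "Dom (Und E) s = Dom (Und E) (esrc \<tau>)"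
        "Cod (Und E) s = Dom (Und E) (esrc \<alpha>)" "far (und_func P) s = esrc \<eta>"
        "esrc \<alpha> \<cdot>\<^bsub>Und E\<^esub> s = esrc \<tau>"
      by atomize_elim (rule U.cartesian_factor[OF src]; use bd' eqs in simp)
    obtain t where t: "t \<in> Arr (Und E)" "Dom (Und E) t = Dom (Und E) (etgt \<tau>)"
        "Cod (Und E) t = Dom (Und E) (etgt \<alpha>)" "far (und_func P) t = etgt \<eta>"
        "etgt \<alpha> \<cdot>\<^bsub>Und E\<^esub> t = etgt \<tau>"
      by atomize_elim (rule U.cartesian_factor[OF two_cartesian_cartesian[OF tgt]];
          use bd' eqs in simp)
    obtain \<zeta> where \<zeta>: "\<zeta> \<in> Arr (Ver E)" "Dom (Ver E) \<zeta> = Dom (Ver E) (cell \<tau>)"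
        "Cod (Ver E) \<zeta> = Dom (Ver E) (cell \<alpha> \<star>\<^bsub>E\<^esub> Idn (Ver E) s)"
        "on2 P \<zeta> = Idn (Ver B) (on1 P (etgt \<alpha>)) \<star>\<^bsub>B\<^esub> cell \<eta>"
        "(cell \<alpha> \<star>\<^bsub>E\<^esub> Idn (Ver E) s) \<cdot>\<^bsub>Ver E\<^esub> \<zeta> = cell \<tau>"
      by atomize_elim (rule cartesian_two_cell_factor[OF stable[OF s(1,3)]];
          use bd' eqs(1,2)[symmetric] eqs(3) s t in \<open>simp add: E.U.Cmp_ac B.U.Cmp_ac\<close>)
    have t_assoc: "etgt \<alpha> \<cdot>\<^bsub>Und E\<^esub> (t \<cdot>\<^bsub>Und E\<^esub> idom \<tau>) = etgt \<tau> \<cdot>\<^bsub>Und E\<^esub> idom \<tau>"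
      using E.U.Cmp_ac[of "idom \<tau>" t "etgt \<alpha>"] bd' t by simp
    \<comment> \<open>Both ends of \<zeta> are now composites with \<open>etgt \<alpha>\<close>: the
      domain because \<open>t\<close> factors \<open>etgt \<tau>\<close>, the codomain because it is
      the domain of the whiskered cell.\<close>
    obtain \<kappa> where \<kappa>: "\<kappa> \<in> Arr (Ver E)" "Dom (Ver E) \<kappa> = t \<cdot>\<^bsub>Und E\<^esub> idom \<tau>"
        "Cod (Ver E) \<kappa> = idom \<alpha> \<cdot>\<^bsub>Und E\<^esub> s"
        "on2 P \<kappa> = cell \<eta>" "Idn (Ver E) (etgt \<alpha>) \<star>\<^bsub>E\<^esub> \<kappa> = \<zeta>"
      by atomize_elim (rule two_cartesian_factor[OF tgt];
          use bd' eqs s t t_assoc \<zeta> in \<open>simp add: E.U.Cmp_ac B.U.Cmp_ac\<close>)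
    let ?k = "Quintet (idom \<tau>) (idom \<alpha>) s t \<kappa>"
    show "\<exists>k. k \<in> Arr (quintet_cat E) \<and> Dom (quintet_cat E) k = Dom (quintet_cat E) \<tau> \<and>
        Cod (quintet_cat E) k = Dom (quintet_cat E) \<alpha> \<and> far (F1 (quintets_func P)) k = \<eta> \<and>
        \<alpha> \<cdot>\<^bsub>quintet_cat E\<^esub> k = \<tau>"
      using bd' s t \<zeta> \<kappa>
      by (intro exI[of _ ?k]) (simp add: Arr_quintet_cat Cmp_quintet_cat quintet.expand)
  next
    fix k k'
    assume "k \<in> Arr (quintet_cat E)" "k' \<in> Arr (quintet_cat E)"
      "Dom (quintet_cat E) k = Dom (quintet_cat E) k'"
      "Cod (quintet_cat E) k = Dom (quintet_cat E) \<alpha>" "Cod (quintet_cat E) k' = Dom (quintet_cat E) \<alpha>"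
      and im: "far (F1 (quintets_func P)) k = far (F1 (quintets_func P)) k'"
      and eq: "\<alpha> \<cdot>\<^bsub>quintet_cat E\<^esub> k = \<alpha> \<cdot>\<^bsub>quintet_cat E\<^esub> k'"
    note bd = this(1-5)[simplified] \<alpha>
    note bd' = bd[unfolded Arr_quintet_cat]
    have im': "on1 P (esrc k) = on1 P (esrc k')" "on1 P (etgt k) = on1 P (etgt k')"
        "on2 P (cell k) = on2 P (cell k')"
      using arg_cong[OF im, of esrc] arg_cong[OF im, of etgt] arg_cong[OF im, of cell] by simp_all
    have eqs: "esrc \<alpha> \<cdot>\<^bsub>Und E\<^esub> esrc k = esrc \<alpha> \<cdot>\<^bsub>Und E\<^esub> esrc k'"
      "etgt \<alpha> \<cdot>\<^bsub>Und E\<^esub> etgt k = etgt \<alpha> \<cdot>\<^bsub>Und E\<^esub> etgt k'"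
      "(cell \<alpha> \<star>\<^bsub>E\<^esub> Idn (Ver E) (esrc k)) \<cdot>\<^bsub>Ver E\<^esub> (Idn (Ver E) (etgt \<alpha>) \<star>\<^bsub>E\<^esub> cell k) =
        (cell \<alpha> \<star>\<^bsub>E\<^esub> Idn (Ver E) (esrc k')) \<cdot>\<^bsub>Ver E\<^esub> (Idn (Ver E) (etgt \<alpha>) \<star>\<^bsub>E\<^esub> cell k')"
      using arg_cong[OF eq, of esrc] arg_cong[OF eq, of etgt] arg_cong[OF eq, of cell]
      by (simp_all add: Cmp_quintet_cat)
    \<comment> \<open>The external sides come before the cells: only once they agree are the two
      cells parallel, so that cancellation applies to them.\<close>
    have s: "esrc k = esrc k'"
      by (rule U.cartesian_cancel[OF src]; use bd' im' eqs in simp)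
    have t: "etgt k = etgt k'"
      by (rule U.cartesian_cancel[OF two_cartesian_cartesian[OF tgt]]; use bd' im' eqs in simp)
    have "Idn (Ver E) (etgt \<alpha>) \<star>\<^bsub>E\<^esub> cell k = Idn (Ver E) (etgt \<alpha>) \<star>\<^bsub>E\<^esub> cell k'"
      by (rule cartesian_two_cell_cancel[OF stable[of "esrc k'"]];
          use bd' im' eqs s t in \<open>simp add: E.U.Cmp_ac\<close>)
    then have "cell k = cell k'"
      using two_cartesian_cancel[OF tgt, of "cell k'" "cell k"] bd' im' s t by simp
    then show "k = k'" using bd s t by (simp add: quintet.expand)
  qed
qed

end

section \<open>From 2-fibrations to double fibrations\<close>

text \<open>Factorizations through \<alpha> and \<beta> exist separately and must be glued. The
  target of the one and the source of the other factor the same arrow through the shared side and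
  have equal images, so they coincide because that side is Cartesian.\<close>

lemma cartesian_composables:
  assumes "strict_double_functor D D' R"
    and \<alpha>: "cartesian (D1 D) (D1 D') (F1 R) \<alpha>" and \<beta>: "cartesian (D1 D) (D1 D') (F1 R) \<beta>"
    and \<alpha>\<beta>: "far (Tgt D) \<alpha> = far (Src D) \<beta>"
    and mid: "cartesian (D0 D) (D0 D') (F0 R) (far (Tgt D) \<alpha>)"
  shows "cartesian (composables D) (composables D') (composables_func R) (\<alpha>, \<beta>)"
proof -
  interpret strict_double_functor D D' R by fact
  interpret C: cat_functor "composables D" "composables D'" "composables_func R"
    by (rule functor_composables) fact
  note A = P1.cartesian_Arr[OF \<alpha>] P1.cartesian_Arr[OF \<beta>]
  show ?thesis
  proof (rule C.cartesianI)
    show "(\<alpha>, \<beta>) \<in> Arr (composables D)" using A \<alpha>\<beta> by simp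
  next
    fix g h
    assume H: "g \<in> Arr (composables D)" "Cod (composables D) g = Cod (composables D) (\<alpha>, \<beta>)"
      "h \<in> Arr (composables D')"
      "Dom (composables D') h = fob (composables_func R) (Dom (composables D) g)"
      "Cod (composables D') h = fob (composables_func R) (Dom (composables D) (\<alpha>, \<beta>))"
      "far (composables_func R) (\<alpha>, \<beta>) \<cdot>\<^bsub>composables D'\<^esub> h = far (composables_func R) g"
    obtain g1 g2 h1 h2 where gh: "g = (g1, g2)" "h = (h1, h2)" by (cases g; cases h)
    have g: "g1 \<in> Arr (D1 D)" "Cod (D1 D) g1 = Cod (D1 D) \<alpha>" "h1 \<in> Arr (D1 D')"
        "Dom (D1 D') h1 = fob (F1 R) (Dom (D1 D) g1)" "Cod (D1 D') h1 = fob (F1 R) (Dom (D1 D) \<alpha>)"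
        "far (F1 R) \<alpha> \<cdot>\<^bsub>D1 D'\<^esub> h1 = far (F1 R) g1"
        "g2 \<in> Arr (D1 D)" "Cod (D1 D) g2 = Cod (D1 D) \<beta>" "h2 \<in> Arr (D1 D')"
        "Dom (D1 D') h2 = fob (F1 R) (Dom (D1 D) g2)" "Cod (D1 D') h2 = fob (F1 R) (Dom (D1 D) \<beta>)"
        "far (F1 R) \<beta> \<cdot>\<^bsub>D1 D'\<^esub> h2 = far (F1 R) g2"
        "far (Tgt D) g1 = far (Src D) g2" "far (Tgt D') h1 = far (Src D') h2"
      using H by (simp_all add: gh)
    obtain k1 where k1: "k1 \<in> Arr (D1 D)" "Dom (D1 D) k1 = Dom (D1 D) g1"
        "Cod (D1 D) k1 = Dom (D1 D) \<alpha>" "far (F1 R) k1 = h1" "\<alpha> \<cdot>\<^bsub>D1 D\<^esub> k1 = g1"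
      by atomize_elim (rule P1.cartesian_factor[OF \<alpha>]; use g in simp)
    obtain k2 where k2: "k2 \<in> Arr (D1 D)" "Dom (D1 D) k2 = Dom (D1 D) g2"
        "Cod (D1 D) k2 = Dom (D1 D) \<beta>" "far (F1 R) k2 = h2" "\<beta> \<cdot>\<^bsub>D1 D\<^esub> k2 = g2"
      by atomize_elim (rule P1.cartesian_factor[OF \<beta>]; use g in simp)
    have dom: "fob (Tgt D) (Dom (D1 D) g1) = fob (Src D) (Dom (D1 D) g2)"
      "fob (Tgt D) (Dom (D1 D) \<alpha>) = fob (Src D) (Dom (D1 D) \<beta>)"
      using E.T.far_simps(2)[of g1] E.S.far_simps(2)[of g2] E.T.far_simps(2)[of \<alpha>]
        E.S.far_simps(2)[of \<beta>] g A \<alpha>\<beta>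
      by simp_all
    have "far (Tgt D) \<alpha> \<cdot>\<^bsub>D0 D\<^esub> far (Tgt D) k1 = far (Tgt D) g1"
      using E.T.far_Cmp_Arr[of k1 \<alpha>] k1 A by simp
    moreover have "far (Src D) \<beta> \<cdot>\<^bsub>D0 D\<^esub> far (Src D) k2 = far (Src D) g2"
      using E.S.far_Cmp_Arr[of k2 \<beta>] k2 A by simp
    moreover have "far (F0 R) (far (Tgt D) k1) = far (F0 R) (far (Src D) k2)"
      using P_Tgt(2)[of k1] P_Src(2)[of k2] k1 k2 g by simp
    ultimately have "far (Tgt D) k1 = far (Src D) k2"
      by (intro P0.cartesian_cancel[OF mid, of "far (Tgt D) k1" "far (Src D) k2"])
        (use k1 k2 g A dom \<alpha>\<beta> in simp_all)
    then show "\<exists>k. k \<in> Arr (composables D) \<and> Dom (composables D) k = Dom (composables D) g \<and>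
        Cod (composables D) k = Dom (composables D) (\<alpha>, \<beta>) \<and> far (composables_func R) k = h \<and>
        (\<alpha>, \<beta>) \<cdot>\<^bsub>composables D\<^esub> k = g"
      using k1 k2 by (intro exI[of _ "(k1, k2)"]) (simp add: gh)
  next
    fix k k'
    assume k: "k \<in> Arr (composables D)" "k' \<in> Arr (composables D)"
      "Dom (composables D) k = Dom (composables D) k'"
      "Cod (composables D) k = Dom (composables D) (\<alpha>, \<beta>)"
      "Cod (composables D) k' = Dom (composables D) (\<alpha>, \<beta>)"
      "far (composables_func R) k = far (composables_func R) k'"
      "(\<alpha>, \<beta>) \<cdot>\<^bsub>composables D\<^esub> k = (\<alpha>, \<beta>) \<cdot>\<^bsub>composables D\<^esub> k'"
    then show "k = k'"
      using P1.cartesian_cancel[OF \<alpha>, of "fst k" "fst k'"]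
        P1.cartesian_cancel[OF \<beta>, of "snd k" "snd k'"]
      by (cases k; cases k') simp
  qed
qed

section \<open>Comparison with a 2-Cartesian lift\<close>

context two_functor
begin

text \<open>The comparison isomorphisms \<open>i\<close> and \<open>j\<close> lie over identities.
  Whiskering with them carries the lifting problem for 2-cells from \<open>f\<close> to
  \<open>f'\<close> and back without changing images.\<close>

lemma cartesian_imp_two_cartesian:
  assumes f: "cartesian (Und E) (Und B) (und_func P) f" and f': "two_cartesian E B P f'"
    and cod: "Cod (Und E) f = Cod (Und E) f'" and im: "on1 P f = on1 P f'"
  shows "two_cartesian E B P f"
proof -
  note fA = U.cartesian_Arr[OF f] and fA' = U.cartesian_Arr[OF two_cartesian_cartesian[OF f']]
  obtain i j where i: "i \<in> Arr (Und E)" "Dom (Und E) i = Dom (Und E) f"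
      "Cod (Und E) i = Dom (Und E) f'" "j \<in> Arr (Und E)" "Dom (Und E) j = Dom (Und E) f'"
      "Cod (Und E) j = Dom (Und E) f"
      "i \<cdot>\<^bsub>Und E\<^esub> j = Idn (Und E) (Dom (Und E) f')" "j \<cdot>\<^bsub>Und E\<^esub> i = Idn (Und E) (Dom (Und E) f)"
      "f' \<cdot>\<^bsub>Und E\<^esub> i = f" "f \<cdot>\<^bsub>Und E\<^esub> j = f'"
      "on1 P i = Idn (Und B) (on0 P (Dom (Und E) f))"
      "on1 P j = Idn (Und B) (on0 P (Dom (Und E) f'))"
    using U.cartesian_unique_iso[OF f two_cartesian_cartesian[OF f'] cod] im
    unfolding func_simps by metis
  have dom: "on0 P (Dom (Und E) f) = on0 P (Dom (Und E) f')"
    using on_simps(4)[OF fA] on_simps(4)[OF fA'] im by simp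
  have ij: "i \<cdot>\<^bsub>Und E\<^esub> (j \<cdot>\<^bsub>Und E\<^esub> h) = h" if "h \<in> Arr (Und E)" "Cod (Und E) h = Dom (Und E) f'" for h
    using that i by (simp flip: E.U.Cmp_ac)
  have ji: "j \<cdot>\<^bsub>Und E\<^esub> (i \<cdot>\<^bsub>Und E\<^esub> h) = h" if "h \<in> Arr (Und E)" "Cod (Und E) h = Dom (Und E) f" for h
    using that i by (simp flip: E.U.Cmp_ac)
  have f'i: "f' \<cdot>\<^bsub>Und E\<^esub> (i \<cdot>\<^bsub>Und E\<^esub> h) = f \<cdot>\<^bsub>Und E\<^esub> h"
    if "h \<in> Arr (Und E)" "Cod (Und E) h = Dom (Und E) f" for h
    using that i fA' by (simp flip: E.U.Cmp_ac)
  have whisk: "Idn (Ver E) f' \<star>\<^bsub>E\<^esub> (Idn (Ver E) i \<star>\<^bsub>E\<^esub> \<gamma>) = Idn (Ver E) f \<star>\<^bsub>E\<^esub> \<gamma>"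
      "Idn (Ver E) j \<star>\<^bsub>E\<^esub> (Idn (Ver E) i \<star>\<^bsub>E\<^esub> \<gamma>) = \<gamma>"
    if "\<gamma> \<in> Arr (Ver E)" "Cod (Und E) (Dom (Ver E) \<gamma>) = Dom (Und E) f" for \<gamma>
    using that i fA' by (simp_all flip: E.whisker_whisker(1))
  have whisk': "Idn (Ver E) f \<star>\<^bsub>E\<^esub> (Idn (Ver E) j \<star>\<^bsub>E\<^esub> \<gamma>) = Idn (Ver E) f' \<star>\<^bsub>E\<^esub> \<gamma>"
    if "\<gamma> \<in> Arr (Ver E)" "Cod (Und E) (Dom (Ver E) \<gamma>) = Dom (Und E) f'" for \<gamma>
    using that i fA by (simp flip: E.whisker_whisker(1))
  show ?thesis
  proof (rule two_cartesianI[OF f])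
    fix h l \<theta> \<gamma>
    assume H: "h \<in> Arr (Und E)" "l \<in> Arr (Und E)" "Dom (Und E) l = Dom (Und E) h"
      "Cod (Und E) h = Dom (Und E) f" "Cod (Und E) l = Dom (Und E) f"
      "\<theta> \<in> Arr (Ver E)" "Dom (Ver E) \<theta> = f \<cdot>\<^bsub>Und E\<^esub> h" "Cod (Ver E) \<theta> = f \<cdot>\<^bsub>Und E\<^esub> l"
      "\<gamma> \<in> Arr (Ver B)" "Dom (Ver B) \<gamma> = on1 P h" "Cod (Ver B) \<gamma> = on1 P l"
      "on2 P \<theta> = Idn (Ver B) (on1 P f) \<star>\<^bsub>B\<^esub> \<gamma>"
    \<comment> \<open>Since \<open>f' \<cdot> i = f\<close>, the given \<theta> is also a 2-cell
      between composites with \<open>f'\<close>. Whiskering the resulting lift by \<open>j\<close>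
      restores the ends \<open>h\<close> and \<open>l\<close>.\<close>
    obtain \<delta> where \<delta>: "\<delta> \<in> Arr (Ver E)" "Dom (Ver E) \<delta> = i \<cdot>\<^bsub>Und E\<^esub> h"
        "Cod (Ver E) \<delta> = i \<cdot>\<^bsub>Und E\<^esub> l" "on2 P \<delta> = \<gamma>" "Idn (Ver E) f' \<star>\<^bsub>E\<^esub> \<delta> = \<theta>"
      by atomize_elim (rule two_cartesian_factor[OF f']; use H i fA fA' im dom f'i in simp)
    have "on2 P (Idn (Ver E) j \<star>\<^bsub>E\<^esub> \<delta>) = \<gamma>"
      using \<delta> H i dom by simp
    then show "\<exists>\<gamma>'. \<gamma>' \<in> Arr (Ver E) \<and> Dom (Ver E) \<gamma>' = h \<and> Cod (Ver E) \<gamma>' = l \<and>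
        on2 P \<gamma>' = \<gamma> \<and> Idn (Ver E) f \<star>\<^bsub>E\<^esub> \<gamma>' = \<theta>"
      using \<delta> H i(1-6) ji whisk'[of \<delta>]
      by (intro exI[of _ "Idn (Ver E) j \<star>\<^bsub>E\<^esub> \<delta>"]) simp
  next
    fix \<gamma> \<gamma>'
    assume H: "\<gamma> \<in> Arr (Ver E)" "\<gamma>' \<in> Arr (Ver E)" "Dom (Ver E) \<gamma>' = Dom (Ver E) \<gamma>"
      "Cod (Ver E) \<gamma>' = Cod (Ver E) \<gamma>" "Cod (Und E) (Dom (Ver E) \<gamma>) = Dom (Und E) f"
      "on2 P \<gamma>' = on2 P \<gamma>" "Idn (Ver E) f \<star>\<^bsub>E\<^esub> \<gamma>' = Idn (Ver E) f \<star>\<^bsub>E\<^esub> \<gamma>"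
    have "Idn (Ver E) i \<star>\<^bsub>E\<^esub> \<gamma>' = Idn (Ver E) i \<star>\<^bsub>E\<^esub> \<gamma>"
      by (rule two_cartesian_cancel[OF f']) (use H i(1-6) whisk in simp_all)
    then show "\<gamma>' = \<gamma>" using H whisk(2)[of \<gamma>] whisk(2)[of \<gamma>'] by simp
  qed
qed

lemma cartesian_two_cell_Idn:
  assumes "f \<in> Arr (Und E)"
  shows "cartesian_two_cell E B P (Dom (Und E) f) (Cod (Und E) f) (Idn (Ver E) f)"
proof -
  interpret L: cat_functor "hom_cat E (Dom (Und E) f) (Cod (Und E) f)"
    "hom_cat B (on0 P (Dom (Und E) f)) (on0 P (Cod (Und E) f))" "loc_func P"
    by (rule functor_hom_cat)
  show ?thesis
    unfolding cartesian_two_cell_def using L.cartesian_Idn[of f] assms by (simp add: hom_iff)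
qed

lemma cartesian_two_cell_Cmp:
  assumes \<theta>: "cartesian_two_cell E B P X Y \<theta>" and \<phi>: "cartesian_two_cell E B P X Y \<phi>"
    and "Dom (Ver E) \<phi> = Cod (Ver E) \<theta>"
  shows "cartesian_two_cell E B P X Y (\<phi> \<cdot>\<^bsub>Ver E\<^esub> \<theta>)"
proof -
  interpret L: cat_functor "hom_cat E X Y" "hom_cat B (on0 P X) (on0 P Y)" "loc_func P"
    by (rule functor_hom_cat)
  show ?thesis
    using L.cartesian_Cmp[of \<theta> \<phi>] assms by (simp add: cartesian_two_cell_def)
qed

end

section \<open>Lifting quintets along a 2-fibration\<close>

locale two_fib = two_functor E B P
  for E :: "('o, 'a, 'c) two_cat" and B :: "('p, 'b, 'd) two_cat"
    and P :: "('o, 'a, 'c, 'p, 'b, 'd) two_func" +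
  assumes two_fibration: "two_fibration E B P"
begin

text \<open>Every arrow of the base has a 2-Cartesian lift with which a given Cartesian arrow can be
  compared. Hence any cleavage of the underlying functor automatically consists of 2-Cartesian
  arrows.\<close>

lemma two_cartesian_iff_cartesian:
  "two_cartesian E B P f \<longleftrightarrow> cartesian (Und E) (Und B) (und_func P) f"
proof
  assume f: "cartesian (Und E) (Und B) (und_func P) f"
  note fA = U.cartesian_Arr[OF f]
  have "\<exists>f'. two_cartesian_lift E B P (Cod (Und E) f) (on1 P f) f'"
    using two_fibration fA unfolding two_fibration_def by simp
  then show "two_cartesian E B P f"
    using cartesian_imp_two_cartesian[OF f] by (auto simp: two_cartesian_lift_def)
qed (rule two_cartesian_cartesian)

lemma cartesian_two_cell_HCmp:
  assumes \<theta>: "cartesian_two_cell E B P X Y \<theta>" and \<phi>: "cartesian_two_cell E B P Y Z \<phi>"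
  shows "cartesian_two_cell E B P X Z (\<phi> \<star>\<^bsub>E\<^esub> \<theta>)"
proof -
  have "X \<in> Obj (Und E)" "Y \<in> Obj (Und E)" "Z \<in> Obj (Und E)"
    using cartesian_two_cell_Arr[OF \<theta>] cartesian_two_cell_Arr[OF \<phi>] by auto
  then show ?thesis
    using two_fibration \<theta> \<phi> unfolding two_fibration_def by blast
qed

text \<open>Identity 2-cells are Cartesian, so closure under horizontal composition gives the
  stability under whiskering demanded by \<open>cartesian_quintetI\<close>.\<close>

lemma cartesian_quintet:
  assumes \<alpha>: "\<alpha> \<in> Arr (quintet_cat E)"
    and src: "cartesian (Und E) (Und B) (und_func P) (esrc \<alpha>)"
    and tgt: "cartesian (Und E) (Und B) (und_func P) (etgt \<alpha>)"
    and cell: "cartesian_two_cell E B P (Dom (Und E) (idom \<alpha>)) (Cod (Und E) (icod \<alpha>)) (cell \<alpha>)"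
  shows "cartesian (quintet_cat E) (quintet_cat B) (F1 (quintets_func P)) \<alpha>"
proof (rule cartesian_quintetI[OF \<alpha> src])
  show "two_cartesian E B P (etgt \<alpha>)" using tgt by (simp add: two_cartesian_iff_cartesian)
  fix s
  assume "s \<in> Arr (Und E)" "Cod (Und E) s = Dom (Und E) (esrc \<alpha>)"
  then show "cartesian_two_cell E B P (Dom (Und E) s) (Cod (Und E) (icod \<alpha>))
      (cell \<alpha> \<star>\<^bsub>E\<^esub> Idn (Ver E) s)"
    using cartesian_two_cell_HCmp[OF cartesian_two_cell_Idn[of s]] cell \<alpha>
    by (simp add: Arr_quintet_cat)
qed

text \<open>The external sides are prescribed by an arbitrary cleavage \<kappa> instead of being
  merely Cartesian. One and the same \<kappa> supplies both, as simultaneous preservation of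
  cleavages by source and target requires.\<close>

lemma quintet_lift:
  assumes \<kappa>: "\<And>Y u. Y \<in> Obj (Und E) \<Longrightarrow> u \<in> Arr (Und B) \<Longrightarrow> Cod (Und B) u = on0 P Y
      \<Longrightarrow> cartesian_lift (Und E) (Und B) (und_func P) Y u (\<kappa> Y u)"
    and n: "n \<in> Arr (Und E)" and u: "u \<in> Arr (quintet_cat B)" "icod u = on1 P n"
  shows "\<exists>\<alpha>. \<alpha> \<in> Arr (quintet_cat E) \<and> icod \<alpha> = n \<and> map_quintet (on1 P) (on2 P) \<alpha> = u \<and>
    esrc \<alpha> = \<kappa> (Dom (Und E) n) (esrc u) \<and> etgt \<alpha> = \<kappa> (Cod (Und E) n) (etgt u) \<and>
    cartesian_two_cell E B P (Dom (Und E) (idom \<alpha>)) (Cod (Und E) (icod \<alpha>)) (cell \<alpha>)"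
proof -
  note u' = u(1)[unfolded Arr_quintet_cat] u(2)
  define f where "f = \<kappa> (Dom (Und E) n) (esrc u)"
  define g where "g = \<kappa> (Cod (Und E) n) (etgt u)"
  have f: "cartesian (Und E) (Und B) (und_func P) f" "Cod (Und E) f = Dom (Und E) n" "on1 P f = esrc u"
    using \<kappa>[of "Dom (Und E) n" "esrc u"] n u' by (simp_all add: cartesian_lift_def f_def)
  have g: "cartesian (Und E) (Und B) (und_func P) g" "Cod (Und E) g = Cod (Und E) n" "on1 P g = etgt u"
    using \<kappa>[of "Cod (Und E) n" "etgt u"] n u' by (simp_all add: cartesian_lift_def g_def)
  note A = U.cartesian_Arr[OF f(1)] U.cartesian_Arr[OF g(1)]
  have dom: "on0 P (Dom (Und E) f) = Dom (Und B) (esrc u)"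
      "on0 P (Dom (Und E) g) = Dom (Und B) (etgt u)"
    using on_simps(4)[OF A(1)] on_simps(4)[OF A(2)] f g by simp_all
  let ?X = "Dom (Und E) f" and ?Y = "Cod (Und E) n"
  have "fibration (hom_cat E ?X ?Y) (hom_cat B (on0 P ?X) (on0 P ?Y)) (loc_func P)"
    using two_fibration n A unfolding two_fibration_def by simp
  moreover have "n \<cdot>\<^bsub>Und E\<^esub> f \<in> Obj (hom_cat E ?X ?Y)"
    "cell u \<in> Arr (hom_cat B (on0 P ?X) (on0 P ?Y))"
    "Cod (hom_cat B (on0 P ?X) (on0 P ?Y)) (cell u) = fob (loc_func P) (n \<cdot>\<^bsub>Und E\<^esub> f)"
    using n A f g u' dom by (simp_all add: hom_iff)
  ultimately obtain \<theta> where \<theta>: "cartesian_two_cell E B P ?X ?Y \<theta>"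
      "Cod (Ver E) \<theta> = n \<cdot>\<^bsub>Und E\<^esub> f" "on2 P \<theta> = cell u"
    unfolding fibration_def cartesian_lift_def cartesian_two_cell_def by (metis func_simps(4) hom_cat_simps(3))
  note T = cartesian_two_cell_Arr[OF \<theta>(1)]
  \<comment> \<open>The local lift controls the domain of \<theta> only through its image. That
    image passes through \<open>etgt u\<close>, which is what allows \<open>g\<close> to split off
    the new internal domain \<open>m\<close>.\<close>
  have im: "on1 P (Dom (Ver E) \<theta>) = etgt u \<cdot>\<^bsub>Und B\<^esub> idom u"
    using on_simps(9)[OF T(1)] \<theta> u' by simp
  obtain m where m: "m \<in> Arr (Und E)" "Dom (Und E) m = Dom (Und E) (Dom (Ver E) \<theta>)"
      "Cod (Und E) m = Dom (Und E) g" "far (und_func P) m = idom u" "g \<cdot>\<^bsub>Und E\<^esub> m = Dom (Ver E) \<theta>"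
    by atomize_elim (rule U.cartesian_factor[OF g(1)]; use T im g u' A dom in simp)
  show ?thesis
    using n m T f g \<theta> A u
    by (intro exI[of _ "Quintet m n f g \<theta>"])
      (simp add: Arr_quintet_cat quintet.expand flip: f_def g_def)
qed

lemma double_fibration_quintets:
  "double_fibration (quintets E) (quintets B) (quintets_func P)"
proof -
  interpret Q: cat_functor "quintet_cat E" "quintet_cat B" "F1 (quintets_func P)"
    by (rule functor_quintets)
  have "\<forall>Y u. \<exists>f. Y \<in> Obj (Und E) \<longrightarrow> u \<in> Arr (Und B) \<longrightarrow> Cod (Und B) u = on0 P Y \<longrightarrow>
      cartesian_lift (Und E) (Und B) (und_func P) Y u f"
    using two_fibration unfolding two_fibration_def two_cartesian_lift_def cartesian_lift_def
    by (metis func_simps(2) two_cartesian_cartesian)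
  then obtain \<kappa>0 where \<kappa>0: "\<And>Y u. Y \<in> Obj (Und E) \<Longrightarrow> u \<in> Arr (Und B) \<Longrightarrow> Cod (Und B) u = on0 P Y
      \<Longrightarrow> cartesian_lift (Und E) (Und B) (und_func P) Y u (\<kappa>0 Y u)"
    by metis
  let ?lift = "\<lambda>n u \<alpha>. \<alpha> \<in> Arr (quintet_cat E) \<and> icod \<alpha> = n \<and> map_quintet (on1 P) (on2 P) \<alpha> = u \<and>
    esrc \<alpha> = \<kappa>0 (Dom (Und E) n) (esrc u) \<and> etgt \<alpha> = \<kappa>0 (Cod (Und E) n) (etgt u) \<and>
    cartesian_two_cell E B P (Dom (Und E) (idom \<alpha>)) (Cod (Und E) (icod \<alpha>)) (cell \<alpha>)"
  \<comment> \<open>The choice retains the whole specification, including Cartesianness of the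
    2-cell: the tensor argument needs more about the chosen quintets than that they are
    Cartesian.\<close>
  have "\<forall>n u. \<exists>\<alpha>. n \<in> Arr (Und E) \<longrightarrow> u \<in> Arr (quintet_cat B) \<longrightarrow> icod u = on1 P n \<longrightarrow> ?lift n u \<alpha>"
    using quintet_lift[OF \<kappa>0] by blast
  then obtain \<kappa>1 where \<kappa>1: "\<And>n u. n \<in> Arr (Und E) \<Longrightarrow> u \<in> Arr (quintet_cat B) \<Longrightarrow> icod u = on1 P n
      \<Longrightarrow> ?lift n u (\<kappa>1 n u)"
    by metis
  have cart1: "cartesian (quintet_cat E) (quintet_cat B) (F1 (quintets_func P)) (\<kappa>1 n u)"
    and cart0: "cartesian (Und E) (Und B) (und_func P) (esrc (\<kappa>1 n u))"
      "cartesian (Und E) (Und B) (und_func P) (etgt (\<kappa>1 n u))"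
    if n: "n \<in> Arr (Und E)" "u \<in> Arr (quintet_cat B)" "icod u = on1 P n" for n u
  proof -
    note L = \<kappa>1[OF that]
    show src: "cartesian (Und E) (Und B) (und_func P) (esrc (\<kappa>1 n u))"
      using L \<kappa>0[of "Dom (Und E) n" "esrc u"] n by (simp add: cartesian_lift_def Arr_quintet_cat)
    show tgt: "cartesian (Und E) (Und B) (und_func P) (etgt (\<kappa>1 n u))"
      using L \<kappa>0[of "Cod (Und E) n" "etgt u"] n by (simp add: cartesian_lift_def Arr_quintet_cat)
    show "cartesian (quintet_cat E) (quintet_cat B) (F1 (quintets_func P)) (\<kappa>1 n u)"
      using cartesian_quintet src tgt L by blast
  qed
  have cl0: "cleavage (Und E) (Und B) (und_func P) \<kappa>0"
    using \<kappa>0 by (simp add: cleavage_def)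
  have cl1: "cleavage (quintet_cat E) (quintet_cat B) (F1 (quintets_func P)) \<kappa>1"
    using \<kappa>1 cart1 by (simp add: cleavage_def cartesian_lift_def)
  have fib: "fibration (Und E) (Und B) (und_func P)"
      "fibration (quintet_cat E) (quintet_cat B) (F1 (quintets_func P))"
    using cl0 cl1 U.cat_functor_axioms functor_quintets
    unfolding fibration_def cleavage_def by blast+
  have pres: "cleavage_preserving (quintet_cat E) (quintet_cat B) (F1 (quintets_func P)) \<kappa>1 \<kappa>0
      (Src (quintets E)) (Src (quintets B))"
    "cleavage_preserving (quintet_cat E) (quintet_cat B) (F1 (quintets_func P)) \<kappa>1 \<kappa>0
      (Tgt (quintets E)) (Tgt (quintets B))"
    using \<kappa>1 by (simp_all add: cleavage_preserving_def)
  have unt: "cartesian (quintet_cat E) (quintet_cat B) (F1 (quintets_func P)) (far (Unt (quintets E)) f)"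
    if f: "cartesian (Und E) (Und B) (und_func P) f" for f
    using U.cartesian_Arr[OF f] cartesian_two_cell_Idn[of f]
    by (intro cartesian_quintet) (simp_all add: f far_Unt_quintets Arr_quintet_cat)
  have ten: "cartesian (quintet_cat E) (quintet_cat B) (F1 (quintets_func P))
      (far (Ten (quintets E)) \<alpha>\<beta>)"
    if c: "cartesian (composables (quintets E)) (composables (quintets B))
      (composables_func (quintets_func P)) \<alpha>\<beta>" for \<alpha>\<beta>
  proof -
    interpret C: cat_functor "composables (quintets E)" "composables (quintets B)"
      "composables_func (quintets_func P)"
      by (rule functor_composables) (rule strict_double_functor_quintets)
    obtain \<alpha> \<beta> where \<alpha>\<beta>: "\<alpha>\<beta> = (\<alpha>, \<beta>)" by (cases \<alpha>\<beta>)
    have A: "\<alpha> \<in> Arr (quintet_cat E)" "\<beta> \<in> Arr (quintet_cat E)" "etgt \<alpha> = esrc \<beta>"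
      using C.cartesian_Arr[OF c] by (simp_all add: \<alpha>\<beta>)
    note A' = A[unfolded Arr_quintet_cat]
    let ?u = "map_quintet (on1 P) (on2 P) \<alpha>" and ?v = "map_quintet (on1 P) (on2 P) \<beta>"
    have uv: "icod \<alpha> \<in> Arr (Und E)" "?u \<in> Arr (quintet_cat B)" "icod ?u = on1 P (icod \<alpha>)"
      "icod \<beta> \<in> Arr (Und E)" "?v \<in> Arr (quintet_cat B)" "icod ?v = on1 P (icod \<beta>)"
      using A' Q.far_simps(1)[OF A(1)] Q.far_simps(1)[OF A(2)] by simp_all
    \<comment> \<open>Nothing is known about \<alpha> and \<beta> individually, so they are replaced
      by the chosen lifts of their images along the same internal codomains.\<close>
    define \<alpha>' where "\<alpha>' = \<kappa>1 (icod \<alpha>) ?u"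
    define \<beta>' where "\<beta>' = \<kappa>1 (icod \<beta>) ?v"
    note L = \<kappa>1[OF uv(1-3), folded \<alpha>'_def] \<kappa>1[OF uv(4-6), folded \<beta>'_def]
    note ca = cart1[OF uv(1-3), folded \<alpha>'_def] cart0[OF uv(1-3), folded \<alpha>'_def]
    note cb = cart1[OF uv(4-6), folded \<beta>'_def] cart0[OF uv(4-6), folded \<beta>'_def]
    \<comment> \<open>The replacements remain composable because both sides are the value of
      \<open>\<kappa>0\<close> at the same object and the same base arrow.\<close>
    have mid: "etgt \<alpha>' = esrc \<beta>'"
      using L A' by simp
    have c': "cartesian (composables (quintets E)) (composables (quintets B))
        (composables_func (quintets_func P)) (\<alpha>', \<beta>')"
      using ca cb mid by (intro cartesian_composables strict_double_functor_quintets) simp_all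
    have LA: "\<alpha>' \<in> Arr (quintet_cat E)" "\<beta>' \<in> Arr (quintet_cat E)" using L by blast+
    note B' = LA[unfolded Arr_quintet_cat] mid
    have cell: "cartesian_two_cell E B P (Dom (Und E) (idom \<alpha>')) (Cod (Und E) (icod \<alpha>')) (cell \<alpha>')"
      "cartesian_two_cell E B P (Dom (Und E) (idom \<beta>')) (Cod (Und E) (icod \<beta>')) (cell \<beta>')"
      using L by blast+
    \<comment> \<open>The cell of the tensor is a vertical composite of two whiskered cells, and
      each of them is a horizontal composite with an identity 2-cell.\<close>
    have "cartesian_two_cell E B P (Dom (Und E) (idom \<alpha>')) (Cod (Und E) (icod \<beta>'))
        (Idn (Ver E) (icod \<beta>') \<star>\<^bsub>E\<^esub> cell \<alpha>')"
      by (rule cartesian_two_cell_HCmp[OF cell(1)])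
        (use B' cartesian_two_cell_Idn[of "icod \<beta>'"] in simp)
    moreover have "cartesian_two_cell E B P (Dom (Und E) (idom \<alpha>')) (Cod (Und E) (icod \<beta>'))
        (cell \<beta>' \<star>\<^bsub>E\<^esub> Idn (Ver E) (idom \<alpha>'))"
      by (rule cartesian_two_cell_HCmp[OF _ cell(2)])
        (use B' cartesian_two_cell_Idn[of "idom \<alpha>'"] in simp)
    ultimately have "cartesian_two_cell E B P (Dom (Und E) (idom \<alpha>')) (Cod (Und E) (icod \<beta>'))
        (cell (far (Ten (quintets E)) (\<alpha>', \<beta>')))"
      unfolding far_Ten_quintets quintet.sel
      using B' by (intro cartesian_two_cell_Cmp) (simp_all add: E.U.Cmp_ac)
    then have "cartesian (quintet_cat E) (quintet_cat B) (F1 (quintets_func P))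
        (far (Ten (quintets E)) (\<alpha>', \<beta>'))"
      using B' ca(2) cb(3) E.Arr_Ten_quintets[OF LA mid]
      by (intro cartesian_quintet) (simp_all add: far_Ten_quintets)
    \<comment> \<open>The original and the replaced pair are Cartesian over the same pair with the
      same codomain, so the tensor, being a functor, transports the result.\<close>
    then have "cartesian (quintet_cat E) (quintet_cat B) (F1 (quintets_func P))
        (far (Ten (quintets E)) (\<alpha>, \<beta>))"
      using L
      by (intro cartesian_image_transfer[OF C.cat_functor_axioms functor_quintets
            E.functor_Ten_quintets c[unfolded \<alpha>\<beta>] c']) simp_all
    then show ?thesis by (simp add: \<alpha>\<beta>)
  qed
  show ?thesis
    unfolding double_fibration_def cartesian_preserving_def
    using strict_double_functor_quintets fib cl0 cl1 pres unt ten by auto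
qed

end

section \<open>From double fibrations to 2-fibrations\<close>

locale double_fib = two_functor E B P
  for E :: "('o, 'a, 'c) two_cat" and B :: "('p, 'b, 'd) two_cat"
    and P :: "('o, 'a, 'c, 'p, 'b, 'd) two_func" +
  assumes double_fibration: "double_fibration (quintets E) (quintets B) (quintets_func P)"
begin

abbreviation cartesian_quintet :: "('a, 'c) quintet \<Rightarrow> bool" where
  "cartesian_quintet \<equiv> cartesian (quintet_cat E) (quintet_cat B) (F1 (quintets_func P))"

abbreviation incl :: "'c \<Rightarrow> ('a, 'c) quintet" where
  "incl \<equiv> far (quintet_incl E)"

sublocale Q: cat_functor "quintet_cat E" "quintet_cat B" "F1 (quintets_func P)"
  by (rule functor_quintets)

text \<open>A 2-cell from \<open>f \<cdot> h\<close> to \<open>f \<cdot> l\<close> is a quintet between identities whose codomain is that of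
  the external unit on \<open>f\<close>; the Cartesian property of this unit provides the lift.\<close>

lemma two_cartesian_if_cartesian:
  assumes f: "cartesian (Und E) (Und B) (und_func P) f"
  shows "two_cartesian E B P f"
proof (rule two_cartesianI[OF f])
  note fA = U.cartesian_Arr[OF f]
  let ?U = "far (Unt (quintets E)) f" and ?X = "Dom (Und E) f"
  have unt: "cartesian_quintet ?U"
    using double_fibration f by (simp add: double_fibration_def cartesian_preserving_def)
  {
    fix h l \<theta> \<gamma>
    assume H: "h \<in> Arr (Und E)" "l \<in> Arr (Und E)" "Dom (Und E) l = Dom (Und E) h"
      "Cod (Und E) h = ?X" "Cod (Und E) l = ?X"
      "\<theta> \<in> Arr (Ver E)" "Dom (Ver E) \<theta> = f \<cdot>\<^bsub>Und E\<^esub> h" "Cod (Ver E) \<theta> = f \<cdot>\<^bsub>Und E\<^esub> l"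
      "\<gamma> \<in> Arr (Ver B)" "Dom (Ver B) \<gamma> = on1 P h" "Cod (Ver B) \<gamma> = on1 P l"
      "on2 P \<theta> = Idn (Ver B) (on1 P f) \<star>\<^bsub>B\<^esub> \<gamma>"
    let ?Z = "Dom (Und E) h"
    \<comment> \<open>A quintet cell runs from target side to source side. The domain
      \<open>f \<cdot> h\<close> of \<theta> therefore becomes the external target and its codomain
      \<open>f \<cdot> l\<close> the external source.\<close>
    let ?g = "Quintet (Idn (Und E) ?Z) (Idn (Und E) (Cod (Und E) f)) (f \<cdot>\<^bsub>Und E\<^esub> l) (f \<cdot>\<^bsub>Und E\<^esub> h) \<theta>"
    let ?h = "Quintet (Idn (Und B) (on0 P ?Z)) (Idn (Und B) (on0 P ?X)) (on1 P l) (on1 P h) \<gamma>"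
    obtain k where k: "k \<in> Arr (quintet_cat E)"
        "Dom (quintet_cat E) k = Dom (quintet_cat E) ?g"
        "Cod (quintet_cat E) k = Dom (quintet_cat E) ?U"
        "far (F1 (quintets_func P)) k = ?h" "?U \<cdot>\<^bsub>quintet_cat E\<^esub> k = ?g"
      by atomize_elim (rule Q.cartesian_factor[OF unt];
          use H fA in \<open>simp add: far_Unt_quintets Arr_quintet_cat Cmp_quintet_cat\<close>)
    note k' = k(1)[unfolded Arr_quintet_cat] k(2,3)[simplified, unfolded far_Unt_quintets quintet.sel]
    have im: "on1 P (esrc k) = on1 P l" "on1 P (etgt k) = on1 P h" "on2 P (cell k) = \<gamma>"
      using arg_cong[OF k(4), of esrc] arg_cong[OF k(4), of etgt] arg_cong[OF k(4), of cell]
      by simp_all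
    have eq: "f \<cdot>\<^bsub>Und E\<^esub> esrc k = f \<cdot>\<^bsub>Und E\<^esub> l" "f \<cdot>\<^bsub>Und E\<^esub> etgt k = f \<cdot>\<^bsub>Und E\<^esub> h"
      "(Idn (Ver E) f \<star>\<^bsub>E\<^esub> Idn (Ver E) (esrc k)) \<cdot>\<^bsub>Ver E\<^esub> (Idn (Ver E) f \<star>\<^bsub>E\<^esub> cell k) = \<theta>"
      using k(5) by (simp_all add: far_Unt_quintets Cmp_quintet_cat)
    \<comment> \<open>Factoring through the unit fixes the sides of \<open>k\<close> only by their
      images and their composites with \<open>f\<close>; Cartesianness of \<open>f\<close>
      identifies them with \<open>l\<close> and \<open>h\<close>.\<close>
    have st: "esrc k = l" "etgt k = h"
      using U.cartesian_cancel[OF f, of "esrc k" l] U.cartesian_cancel[OF f, of "etgt k" h]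
        k' im eq H fA by simp_all
    show "\<exists>\<gamma>'. \<gamma>' \<in> Arr (Ver E) \<and> Dom (Ver E) \<gamma>' = h \<and> Cod (Ver E) \<gamma>' = l \<and>
        on2 P \<gamma>' = \<gamma> \<and> Idn (Ver E) f \<star>\<^bsub>E\<^esub> \<gamma>' = \<theta>"
      using k' im(3) eq(3) st H fA by (intro exI[of _ "cell k"]) simp
  next
    fix \<gamma> \<gamma>'
    assume H: "\<gamma> \<in> Arr (Ver E)" "\<gamma>' \<in> Arr (Ver E)" "Dom (Ver E) \<gamma>' = Dom (Ver E) \<gamma>"
      "Cod (Ver E) \<gamma>' = Cod (Ver E) \<gamma>" "Cod (Und E) (Dom (Ver E) \<gamma>) = ?X"
      "on2 P \<gamma>' = on2 P \<gamma>" "Idn (Ver E) f \<star>\<^bsub>E\<^esub> \<gamma>' = Idn (Ver E) f \<star>\<^bsub>E\<^esub> \<gamma>"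
    let ?q = "\<lambda>\<gamma>. Quintet (Idn (Und E) (Dom (Und E) (Dom (Ver E) \<gamma>))) (Idn (Und E) ?X)
      (Cod (Ver E) \<gamma>) (Dom (Ver E) \<gamma>) \<gamma>"
    have "Dom (Und E) (Cod (Ver E) \<gamma>) = Dom (Und E) (Dom (Ver E) \<gamma>)"
      "Cod (Und E) (Cod (Ver E) \<gamma>) = ?X"
      using H by simp_all
    then have "?q \<gamma>' = ?q \<gamma>"
      using Q.cartesian_cancel[OF unt, of "?q \<gamma>'" "?q \<gamma>"] H fA
      by (simp add: far_Unt_quintets Cmp_quintet_cat Arr_quintet_cat)
    then show "\<gamma>' = \<gamma>" by simp
  }
qed

text \<open>The cleavage need not be normal: the lift of a quintet with identity source and target has
  source and target isomorphisms, so it is precomposed with an invertible quintet.\<close>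

lemma incl_lift:
  assumes k: "k \<in> Arr (Und E)" and u: "u \<in> Arr (Ver B)" "Cod (Ver B) u = on1 P k"
  shows "\<exists>\<phi>. \<phi> \<in> Arr (Ver E) \<and> Cod (Ver E) \<phi> = k \<and> on2 P \<phi> = u \<and> cartesian_quintet (incl \<phi>)"
proof -
  obtain \<kappa>0 \<kappa>1 where \<kappa>: "cleavage (Und E) (Und B) (und_func P) \<kappa>0"
    "cleavage (quintet_cat E) (quintet_cat B) (F1 (quintets_func P)) \<kappa>1"
    "cleavage_preserving (quintet_cat E) (quintet_cat B) (F1 (quintets_func P)) \<kappa>1 \<kappa>0
      (Src (quintets E)) (Src (quintets B))"
    "cleavage_preserving (quintet_cat E) (quintet_cat B) (F1 (quintets_func P)) \<kappa>1 \<kappa>0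
      (Tgt (quintets E)) (Tgt (quintets B))"
    using double_fibration by (auto simp: double_fibration_def)
  let ?X = "Dom (Und E) k" and ?Y = "Cod (Und E) k"
  have bd: "Dom (Und B) (Dom (Ver B) u) = on0 P ?X" "Cod (Und B) (Dom (Ver B) u) = on0 P ?Y"
    using B.Ver_boundary(3,4)[OF u(1)] u k by simp_all
  let ?u = "Quintet (Dom (Ver B) u) (on1 P k) (Idn (Und B) (on0 P ?X)) (Idn (Und B) (on0 P ?Y)) u"
  define \<alpha> where "\<alpha> = \<kappa>1 k ?u"
  have uA: "?u \<in> Arr (quintet_cat B)" using u bd k by (simp add: Arr_quintet_cat)
  \<comment> \<open>Cleavage preservation enters here: it makes both external sides of the lift
    chosen lifts of identities.\<close>
  have \<alpha>: "cartesian_quintet \<alpha>" "icod \<alpha> = k" "map_quintet (on1 P) (on2 P) \<alpha> = ?u"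
    "esrc \<alpha> = \<kappa>0 ?X (Idn (Und B) (on0 P ?X))" "etgt \<alpha> = \<kappa>0 ?Y (Idn (Und B) (on0 P ?Y))"
    using \<kappa> uA k by (simp_all add: cleavage_def cleavage_preserving_def cartesian_lift_def \<alpha>_def)
  note \<alpha>A = Q.cartesian_Arr[OF \<alpha>(1), unfolded Arr_quintet_cat]
  have f: "cartesian (Und E) (Und B) (und_func P) (esrc \<alpha>)" "on1 P (esrc \<alpha>) = Idn (Und B) (on0 P ?X)"
    and g: "cartesian (Und E) (Und B) (und_func P) (etgt \<alpha>)" "on1 P (etgt \<alpha>) = Idn (Und B) (on0 P ?Y)"
    using \<kappa>(1) \<alpha>(4,5) k by (simp_all add: cleavage_def cartesian_lift_def)
  obtain j where j: "j \<in> Arr (Und E)" "Dom (Und E) j = ?X" "Cod (Und E) j = Dom (Und E) (esrc \<alpha>)"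
      "esrc \<alpha> \<cdot>\<^bsub>Und E\<^esub> j = Idn (Und E) ?X"
      "j \<cdot>\<^bsub>Und E\<^esub> esrc \<alpha> = Idn (Und E) (Dom (Und E) (esrc \<alpha>))"
      "on1 P j = Idn (Und B) (on0 P ?X)"
  \<comment> \<open>The side is compared with the identity on its codomain, another Cartesian arrow
    over the same identity. The comparison arrow \<open>i\<close> is then the side itself, and
    \<open>j\<close> is its inverse.\<close>
  proof (rule U.cartesian_unique_iso[OF f(1) U.cartesian_Idn[of ?X]], goal_cases)
    case (4 i j)
    moreover have "i = esrc \<alpha>" using 4 k by simp
    ultimately show ?case using k by simp
  qed (use k \<alpha>A \<alpha>(2) f(2) in simp_all)
  obtain j' where j': "j' \<in> Arr (Und E)" "Dom (Und E) j' = ?Y"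
      "Cod (Und E) j' = Dom (Und E) (etgt \<alpha>)"
      "etgt \<alpha> \<cdot>\<^bsub>Und E\<^esub> j' = Idn (Und E) ?Y"
      "j' \<cdot>\<^bsub>Und E\<^esub> etgt \<alpha> = Idn (Und E) (Dom (Und E) (etgt \<alpha>))"
      "on1 P j' = Idn (Und B) (on0 P ?Y)"
  proof (rule U.cartesian_unique_iso[OF g(1) U.cartesian_Idn[of ?Y]], goal_cases)
    case (4 i j)
    moreover have "i = etgt \<alpha>" using 4 k by simp
    ultimately show ?case using k by simp
  qed (use k \<alpha>A \<alpha>(2) g(2) in simp_all)
  have f_j: "esrc \<alpha> \<cdot>\<^bsub>Und E\<^esub> (j \<cdot>\<^bsub>Und E\<^esub> h) = h" if "h \<in> Arr (Und E)" "Cod (Und E) h = ?X" for h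
    using that j \<alpha>A \<alpha>(2) by (simp flip: E.U.Cmp_ac)
  have j_f: "j' \<cdot>\<^bsub>Und E\<^esub> (etgt \<alpha> \<cdot>\<^bsub>Und E\<^esub> h) = h"
    if "h \<in> Arr (Und E)" "Cod (Und E) h = Dom (Und E) (etgt \<alpha>)" for h
    using that j' \<alpha>A \<alpha>(2) by (simp flip: E.U.Cmp_ac)
  let ?m = "idom \<alpha>" and ?f = "esrc \<alpha>" and ?g = "etgt \<alpha>"
  \<comment> \<open>With the internal domain adjusted by \<open>etgt \<alpha>\<close> and
    \<open>j\<close>, the squares bordered by \<open>j, j'\<close> and by their inverses commute
    strictly. The quintets \<open>?\<iota>\<close> and \<open>?\<iota>'\<close> can thus carry
    identity 2-cells, and precomposing \<alpha> with \<open>?\<iota>\<close> turns both external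
    sides into identities.\<close>
  let ?m' = "?g \<cdot>\<^bsub>Und E\<^esub> (?m \<cdot>\<^bsub>Und E\<^esub> j)"
  let ?\<iota> = "Quintet ?m' ?m j j' (Idn (Ver E) (?m \<cdot>\<^bsub>Und E\<^esub> j))"
  let ?\<iota>' = "Quintet ?m ?m' ?f ?g (Idn (Ver E) (?g \<cdot>\<^bsub>Und E\<^esub> ?m))"
  define \<phi> where "\<phi> = cell \<alpha> \<star>\<^bsub>E\<^esub> Idn (Ver E) j"
  note facts = \<alpha>A \<alpha>(2) k j j' f_j j_f
  have "cartesian_quintet ?\<iota>"
    by (rule Q.cartesian_iso[of _ ?\<iota>'])
      (use facts in \<open>simp_all add: Arr_quintet_cat Cmp_quintet_cat Idn_quintet_cat E.U.Cmp_ac\<close>)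
  then have "cartesian_quintet (\<alpha> \<cdot>\<^bsub>quintet_cat E\<^esub> ?\<iota>)"
    by (intro Q.cartesian_Cmp \<alpha>(1)) simp_all
  moreover have "\<alpha> \<cdot>\<^bsub>quintet_cat E\<^esub> ?\<iota> = incl \<phi>"
    using facts by (simp add: \<phi>_def Cmp_quintet_cat E.U.Cmp_ac)
  moreover have "cell ?u = on2 P (cell \<alpha>)" using \<alpha>(3) by (metis quintet.map_sel(5))
  then have "on2 P \<phi> = u"
    using facts u bd by (simp add: \<phi>_def)
  moreover have "\<phi> \<in> Arr (Ver E)" "Cod (Ver E) \<phi> = k"
    using facts by (simp_all add: \<phi>_def E.U.Cmp_ac)
  ultimately show ?thesis by metis
qed

section \<open>Local lifts and horizontal composition\<close>

text \<open>The inclusion reflects Cartesian arrows: a factorization of one globular quintet through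
  another is itself globular, since its sides become identities after composition with
  identities.\<close>

lemma cartesian_two_cell_if_incl:
  assumes \<phi>: "\<phi> \<in> Arr (Ver E)" "cartesian_quintet (incl \<phi>)"
  shows "cartesian_two_cell E B P (Dom (Und E) (Dom (Ver E) \<phi>)) (Cod (Und E) (Dom (Ver E) \<phi>)) \<phi>"
proof -
  let ?X = "Dom (Und E) (Dom (Ver E) \<phi>)" and ?Y = "Cod (Und E) (Dom (Ver E) \<phi>)"
  interpret L: cat_functor "hom_cat E ?X ?Y" "hom_cat B (on0 P ?X) (on0 P ?Y)" "loc_func P"
    by (rule functor_hom_cat)
  show ?thesis
    unfolding cartesian_two_cell_def
  proof (rule L.cartesianI)
    show "\<phi> \<in> Arr (hom_cat E ?X ?Y)" using \<phi> by simp
    fix \<tau> \<gamma>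
    assume "\<tau> \<in> Arr (hom_cat E ?X ?Y)" "Cod (hom_cat E ?X ?Y) \<tau> = Cod (hom_cat E ?X ?Y) \<phi>"
      "\<gamma> \<in> Arr (hom_cat B (on0 P ?X) (on0 P ?Y))"
      "Dom (hom_cat B (on0 P ?X) (on0 P ?Y)) \<gamma> = fob (loc_func P) (Dom (hom_cat E ?X ?Y) \<tau>)"
      "Cod (hom_cat B (on0 P ?X) (on0 P ?Y)) \<gamma> = fob (loc_func P) (Dom (hom_cat E ?X ?Y) \<phi>)"
      "far (loc_func P) \<phi> \<cdot>\<^bsub>hom_cat B (on0 P ?X) (on0 P ?Y)\<^esub> \<gamma> = far (loc_func P) \<tau>"
    then have H: "\<tau> \<in> Arr (Ver E)" "Dom (Und E) (Dom (Ver E) \<tau>) = ?X"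
      "Cod (Und E) (Dom (Ver E) \<tau>) = ?Y" "Cod (Ver E) \<tau> = Cod (Ver E) \<phi>"
      "\<gamma> \<in> Arr (Ver B)" "Dom (Ver B) \<gamma> = on1 P (Dom (Ver E) \<tau>)"
      "Cod (Ver B) \<gamma> = on1 P (Dom (Ver E) \<phi>)" "on2 P \<phi> \<cdot>\<^bsub>Ver B\<^esub> \<gamma> = on2 P \<tau>"
      by simp_all
    obtain k where k: "k \<in> Arr (quintet_cat E)"
        "Dom (quintet_cat E) k = Dom (quintet_cat E) (incl \<tau>)"
        "Cod (quintet_cat E) k = Dom (quintet_cat E) (incl \<phi>)"
        "far (F1 (quintets_func P)) k = far (quintet_incl B) \<gamma>"
        "incl \<phi> \<cdot>\<^bsub>quintet_cat E\<^esub> k = incl \<tau>"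
      by atomize_elim (rule Q.cartesian_factor[OF \<phi>(2)];
          use H \<phi>(1) in \<open>simp add: Arr_quintet_cat Cmp_quintet_cat\<close>)
    note k' = k(1)[unfolded Arr_quintet_cat] k(2,3)[simplified]
    have st: "esrc k = Idn (Und E) ?X" "etgt k = Idn (Und E) ?Y"
      using k(5) k' H \<phi>(1) by (simp_all add: Cmp_quintet_cat)
    then have "\<phi> \<cdot>\<^bsub>Ver E\<^esub> cell k = \<tau>" "on2 P (cell k) = \<gamma>"
      using k(5) k' H \<phi>(1) arg_cong[OF k(4), of cell] by (simp_all add: Cmp_quintet_cat)
    then show "\<exists>\<kappa>. \<kappa> \<in> Arr (hom_cat E ?X ?Y) \<and> Dom (hom_cat E ?X ?Y) \<kappa> = Dom (hom_cat E ?X ?Y) \<tau> \<and>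
        Cod (hom_cat E ?X ?Y) \<kappa> = Dom (hom_cat E ?X ?Y) \<phi> \<and> far (loc_func P) \<kappa> = \<gamma> \<and>
        \<phi> \<cdot>\<^bsub>hom_cat E ?X ?Y\<^esub> \<kappa> = \<tau>"
      using k' st H \<phi>(1) by (intro exI[of _ "cell k"]) simp
  next
    fix \<kappa> \<kappa>'
    assume H: "\<kappa> \<in> Arr (hom_cat E ?X ?Y)" "\<kappa>' \<in> Arr (hom_cat E ?X ?Y)"
      "Dom (hom_cat E ?X ?Y) \<kappa> = Dom (hom_cat E ?X ?Y) \<kappa>'"
      "Cod (hom_cat E ?X ?Y) \<kappa> = Dom (hom_cat E ?X ?Y) \<phi>"
      "Cod (hom_cat E ?X ?Y) \<kappa>' = Dom (hom_cat E ?X ?Y) \<phi>"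
      "far (loc_func P) \<kappa> = far (loc_func P) \<kappa>'"
      "\<phi> \<cdot>\<^bsub>hom_cat E ?X ?Y\<^esub> \<kappa> = \<phi> \<cdot>\<^bsub>hom_cat E ?X ?Y\<^esub> \<kappa>'"
    then have "incl \<kappa> = incl \<kappa>'"
      using Q.cartesian_cancel[OF \<phi>(2), of "incl \<kappa>" "incl \<kappa>'"] \<phi>(1)
      by (simp add: Cmp_quintet_cat Arr_quintet_cat)
    then show "\<kappa> = \<kappa>'" by simp
  qed
qed

text \<open>Keeps both forms of Cartesianness: the local one provides the fibrations on
  hom-categories, and the one in quintets provides the comparison lift used for arbitrary Cartesian
  2-cells.\<close>

lemma local_lift:
  assumes "k \<in> Arr (Und E)" "u \<in> Arr (Ver B)" "Cod (Ver B) u = on1 P k"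
  shows "\<exists>\<phi>. cartesian_two_cell E B P (Dom (Und E) k) (Cod (Und E) k) \<phi> \<and> Cod (Ver E) \<phi> = k \<and>
    on2 P \<phi> = u \<and> cartesian_quintet (incl \<phi>)"
proof -
  obtain \<phi> where \<phi>: "\<phi> \<in> Arr (Ver E)" "Cod (Ver E) \<phi> = k" "on2 P \<phi> = u" "cartesian_quintet (incl \<phi>)"
    using incl_lift[OF assms] by blast
  have "Dom (Und E) (Dom (Ver E) \<phi>) = Dom (Und E) k" "Cod (Und E) (Dom (Ver E) \<phi>) = Cod (Und E) k"
    using E.Ver_boundary(3,4)[OF \<phi>(1)] \<phi>(2) by simp_all
  then show ?thesis using cartesian_two_cell_if_incl[OF \<phi>(1,4)] \<phi> by auto
qed

text \<open>The quintet factorization problem allows arbitrary external sides, so it does not follow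
  directly from the local one. Instead \<theta> is compared with a lift \<phi> whose inclusion is
  already Cartesian, and the inclusion functor transports this along their isomorphism.\<close>

lemma incl_cartesian:
  assumes \<theta>: "cartesian_two_cell E B P X Y \<theta>"
  shows "cartesian_quintet (incl \<theta>)"
proof -
  note T = cartesian_two_cell_Arr[OF \<theta>]
  have XY: "Dom (Und E) (Cod (Ver E) \<theta>) = X" "Cod (Und E) (Cod (Ver E) \<theta>) = Y"
    using T by simp_all
  obtain \<phi> where \<phi>: "cartesian_two_cell E B P X Y \<phi>" "Cod (Ver E) \<phi> = Cod (Ver E) \<theta>"
      "on2 P \<phi> = on2 P \<theta>" "cartesian_quintet (incl \<phi>)"
    using local_lift[of "Cod (Ver E) \<theta>" "on2 P \<theta>"] T XY by auto
  show ?thesis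
    by (rule cartesian_image_transfer[OF functor_hom_cat functor_quintets E.functor_quintet_incl
          \<theta>[unfolded cartesian_two_cell_def] \<phi>(1)[unfolded cartesian_two_cell_def]])
      (use \<phi> in \<open>simp_all del: quintet_incl_simps\<close>)
qed

text \<open>The two globular quintets share the identity on \<open>Y\<close>, which is Cartesian, so
  they form a Cartesian pair. The unwanted whiskerings in their tensor collapse by
  \<open>HCmp_whisker\<close>, leaving the horizontal composite.\<close>

lemma cartesian_two_cell_HCmp:
  assumes \<theta>: "cartesian_two_cell E B P X Y \<theta>" and \<phi>: "cartesian_two_cell E B P Y Z \<phi>"
  shows "cartesian_two_cell E B P X Z (\<phi> \<star>\<^bsub>E\<^esub> \<theta>)"
proof -
  note T = cartesian_two_cell_Arr[OF \<theta>] cartesian_two_cell_Arr[OF \<phi>]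
  have "Y \<in> Obj (Und E)" using T by auto
  then have "cartesian (Und E) (Und B) (und_func P) (Idn (Und E) Y)"
    by (rule U.cartesian_Idn)
  then have "cartesian (composables (quintets E)) (composables (quintets B))
      (composables_func (quintets_func P)) (incl \<theta>, incl \<phi>)"
    using incl_cartesian[OF \<theta>] incl_cartesian[OF \<phi>] T
    by (intro cartesian_composables strict_double_functor_quintets) simp_all
  then have "cartesian_quintet (far (Ten (quintets E)) (incl \<theta>, incl \<phi>))"
    using double_fibration by (auto simp: double_fibration_def cartesian_preserving_def)
  moreover have "far (Ten (quintets E)) (incl \<theta>, incl \<phi>) = incl (\<phi> \<star>\<^bsub>E\<^esub> \<theta>)"
    using T by (simp add: far_Ten_quintets E.HCmp_whisker)
  ultimately show ?thesis
    using cartesian_two_cell_if_incl[of "\<phi> \<star>\<^bsub>E\<^esub> \<theta>"] T by simp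
qed

lemma cloven_two_fibration: "cloven_two_fibration E B P"
proof -
  have lift1: "\<exists>f. two_cartesian_lift E B P Y u f"
    if "Y \<in> Obj (Und E)" "u \<in> Arr (Und B)" "Cod (Und B) u = on0 P Y" for Y u
  proof -
    have "\<exists>f. cartesian_lift (Und E) (Und B) (und_func P) Y u f"
      using double_fibration that by (simp add: double_fibration_def fibration_def)
    then show ?thesis
      using two_cartesian_if_cartesian by (auto simp: cartesian_lift_def two_cartesian_lift_def)
  qed
  have lift2: "\<exists>\<phi>. cartesian_lift (hom_cat E X Y) (hom_cat B (on0 P X) (on0 P Y)) (loc_func P) k u \<phi>"
    if "k \<in> hom (Und E) X Y" "u \<in> Arr (hom_cat B (on0 P X) (on0 P Y))" "Cod (Ver B) u = on1 P k"
    for X Y k u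
    using local_lift[of k u] that
    by (auto simp: cartesian_lift_def cartesian_two_cell_def hom_iff)
  have "two_fibration E B P"
    unfolding two_fibration_def fibration_def
    using lift1 lift2 functor_hom_cat cartesian_two_cell_HCmp two_functor_axioms by (simp, blast)
  \<comment> \<open>Both cleavages are picked by choice among the lifts already obtained; they need
    not be those of the double fibration, whose quintet lifts can have nonidentity sides.\<close>
  moreover have "\<exists>\<kappa>. \<forall>Y\<in>Obj (Und E). \<forall>u\<in>Arr (Und B). Cod (Und B) u = on0 P Y \<longrightarrow>
      two_cartesian_lift E B P Y u (\<kappa> Y u)"
    by (rule exI[of _ "\<lambda>Y u. SOME f. two_cartesian_lift E B P Y u f"])
      (blast intro: someI_ex lift1)
  moreover have "\<exists>\<kappa>. \<forall>X\<in>Obj (Und E). \<forall>Y\<in>Obj (Und E).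
      cleavage (hom_cat E X Y) (hom_cat B (on0 P X) (on0 P Y)) (loc_func P) (\<kappa> X Y)"
    unfolding cleavage_def hom_cat_simps func_simps
    by (rule exI[of _ "\<lambda>X Y k u. SOME \<phi>. cartesian_lift (hom_cat E X Y)
        (hom_cat B (on0 P X) (on0 P Y)) (loc_func P) k u \<phi>"])
      (blast intro: someI_ex lift2)
  ultimately show ?thesis unfolding cloven_two_fibration_def by blast
qed

end

theorem proposition2p35:
  fixes E :: "('o, 'a, 'c) two_cat"
    and B :: "('p, 'b, 'd) two_cat"
    and P :: "('o, 'a, 'c, 'p, 'b, 'd) two_func"
  assumes "two_category E"
    and "two_category B"
    and "two_functor E B P"
  shows "cloven_two_fibration E B P \<longleftrightarrow>
    double_fibration (quintets E) (quintets B) (quintets_func P)"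
proof
  assume "cloven_two_fibration E B P"
  then have "two_fib E B P"
    using assms(3) by (simp add: cloven_two_fibration_def two_fib_def two_fib_axioms_def)
  then show "double_fibration (quintets E) (quintets B) (quintets_func P)"
    by (rule two_fib.double_fibration_quintets)
next
  assume "double_fibration (quintets E) (quintets B) (quintets_func P)"
  then have "double_fib E B P"
    using assms(3) by (simp add: double_fib_def double_fib_axioms_def)
  then show "cloven_two_fibration E B P"
    by (rule double_fib.cloven_two_fibration)
qed

end
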